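(* Let $P\colon(\mathcal X,F)\to(\mathcal M,G)$ be a morphism in $\mathbf{Fib}(\mathcal A)$. The following statements are equivalent: (I) $P$ is an opfibration in the 2-category $\mathbf{Fib}(\mathcal A)$; (II) $P$ is a fiberwise opfibration in $\mathbf{Fib}(\mathcal A)$ and, for any object $x$ of $\mathcal X$ and any pair of arrows $\alpha\colon a\to Fx$ in $\mathcal A$ and $\beta\colon Px\to m$ in $\mathcal M$ such that $G\beta=1_{Fx}$, the canonical comparison $\omega\colon(\alpha^*\beta)_*\alpha^*x\to\alpha^*\beta_*x$ is an isomorphism; (III) $P$ is a fiberwise opfibration in $\mathbf{Fib}(\mathcal A)$ with globally opcartesian liftings and, for any object $x$ of $\mathcal X$ and any pair of arrows $\alpha\colon a\to Fx$ in $\mathcal A$ and $\beta\colon Px\to m$ in $\mathcal M$ such that $G\beta=1_{Fx}$, the canonical comparison $\omega\colon(\alpha^*\beta)_*\alpha^*x\to\alpha^*\beta_*x$ is an isomorphism.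
   Context: (Op)cartesian arrows, (op)cartesian liftings and Grothendieck (op)fibrations are as usual (an arrow $f$ is $F$-cartesian if whenever $F(g)=F(f)\cdot\psi$, with $g$ and $f$ having the same codomain, there is a unique $h$ with $f\cdot h=g$, $F(h)=\psi$). An arrow $f$ is $F$-vertical if $F(f)$ is an identity. All (op)fibrations are assumed to admit a cleavage. $\mathbf{Fib}(\mathcal A)$ is the 2-category whose objects are fibrations $(\mathcal X,F)$, $F\colon\mathcal X\to\mathcal A$; 1-cells $P\colon(\mathcal X,F)\to(\mathcal M,G)$ are functors with $G\cdot P=F$ sending $F$-cartesian arrows to $G$-cartesian arrows; 2-cells $P\Rightarrow P'$ are natural transformations with $G$-vertical components. The fiber $\mathcal X_a$ of $F$ over $a$ consists of the objects $x$ with $Fx=a$ and the arrows $f$ with $Ff=1_a$. $P$ is a fiberwise opfibration if for every object $a$ of $\mathcal A$ the restriction $P_a\colon\mathcal X_a\to\mathcal M_a$ is an opfibration. It is a fiberwise opfibration with globally opcartesian liftings if moreover the opcartesian liftings in the fibers (i.e. with respect to the $P_a$) are opcartesian with respect to all arrows of $\mathcal X$, i.e. are $P$-opcartesian. Opfibration in a 2-category with comma objects: a 1-cell $p\colon E\to B$ is an opfibration if the canonical 1-cell $r\colon E\downarrow E\to p\downarrow B$ (induced by $p$ applied to the universal 2-cell of $E\downarrow E$) has a left adjoint with identity unit; here $E\downarrow E=1_E\downarrow 1_E$ and $p\downarrow B=p\downarrow 1_B$ are comma objects. In $\mathbf{Fib}(\mathcal A)$ these are concretely: the objects of $P\downarrow(\mathcal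 M,G)$ are triples $(x,\beta\colon Px\to m,m)$ with $G\beta=1_{Fx}$, and arrows to $(x',\beta',m')$ are pairs $(\xi\colon x\to x',\mu\colon m\to m')$ with $\beta'\cdot P\xi=\mu\cdot\beta$. The objects of $(\mathcal X,F)\downarrow(\mathcal X,F)$ are triples $(x_0,\nu\colon x_0\to x_1,x_1)$ with $F\nu=1$, with arrows the commutative squares. Both have the evident functor to $\mathcal A$, and $R(x_0,\nu,x_1)=(x_0,P\nu,Px_1)$. The adjunction is required to live in $\mathbf{Fib}(\mathcal A)$. Canonical comparison $\omega$: for a fiberwise opfibration $P$ in $\mathbf{Fib}(\mathcal A)$ and $x,\alpha,\beta$ as in the statement, let $\hat\beta\colon x\to\beta_*x$ be an opcartesian lifting of $\beta$ at $x$ with respect to $P_{Fx}$, and let $\hat\alpha\colon\alpha^*x\to x$ and $\hat\alpha\colon\alpha^*\beta_*x\to\beta_*x$ be $F$-cartesian liftings of $\alpha$. Let $\alpha^*\hat\beta\colon\alpha^*x\to\alpha^*\beta_*x$ be the unique $F$-vertical arrow with $\hat\alpha\cdot\alpha^*\hat\beta=\hat\beta\cdot\hat\alpha$. Let $\widehat{P\alpha^*\hat\beta}\colon\alpha^*x\to(\alpha^*\beta)_*\alpha^*x$ be an opcartesian lifting of $P(\alpha^*\hat\beta)$ at $\alpha^*x$ with respect to $P_a$. Then $\omega$ is the unique $P$-vertical arrow with $\omega\cdot\widehat{P\alpha^*\hat\beta}=\alpha^*\hat\beta$. *)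

theory Defs
  imports Main
begin

section \<open>Categories and functors\<close>

record ('o, 'a) cat =
  Obj :: "'o set"
  Arr :: "'a set"
  Dom :: "'a \<Rightarrow> 'o"
  Cod :: "'a \<Rightarrow> 'o"
  Ide :: "'o \<Rightarrow> 'a"
  Comp :: "'a \<Rightarrow> 'a \<Rightarrow> 'a"  (infixl "\<cdot>\<index>" 70)

definition hom :: "('o, 'a) cat \<Rightarrow> 'o \<Rightarrow> 'o \<Rightarrow> 'a set" where
  "hom C x y = {f \<in> Arr C. Dom C f = x \<and> Cod C f = y}"

text \<open>The operations are total functions, but nothing is assumed about \<open>Comp\<close> on
  non-composable pairs, nor about any operation outside the carriers.  Composition is in
  applicative order: \<open>g \<cdot>\<^bsub>C\<^esub> f\<close> is \<open>g\<close> after \<open>f\<close>.\<close>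

definition category :: "('o, 'a) cat \<Rightarrow> bool" where
  "category C \<longleftrightarrow>
     (\<forall>f \<in> Arr C. Dom C f \<in> Obj C \<and> Cod C f \<in> Obj C) \<and>
     (\<forall>x \<in> Obj C. Ide C x \<in> hom C x x) \<and>
     (\<forall>f \<in> Arr C. \<forall>g \<in> Arr C. Dom C g = Cod C f \<longrightarrow> g \<cdot>\<^bsub>C\<^esub> f \<in> hom C (Dom C f) (Cod C g)) \<and>
     (\<forall>f \<in> Arr C. f \<cdot>\<^bsub>C\<^esub> Ide C (Dom C f) = f \<and> Ide C (Cod C f) \<cdot>\<^bsub>C\<^esub> f = f) \<and>
     (\<forall>f \<in> Arr C. \<forall>g \<in> Arr C. \<forall>h \<in> Arr C. Dom C g = Cod C f \<longrightarrow> Dom C h = Cod C g \<longrightarrow>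
        (h \<cdot>\<^bsub>C\<^esub> g) \<cdot>\<^bsub>C\<^esub> f = h \<cdot>\<^bsub>C\<^esub> (g \<cdot>\<^bsub>C\<^esub> f))"

definition iso :: "('o, 'a) cat \<Rightarrow> 'a \<Rightarrow> bool" where
  "iso C f \<longleftrightarrow> f \<in> Arr C \<and>
     (\<exists>g \<in> hom C (Cod C f) (Dom C f).
        g \<cdot>\<^bsub>C\<^esub> f = Ide C (Dom C f) \<and> f \<cdot>\<^bsub>C\<^esub> g = Ide C (Cod C f))"

record ('o, 'a, 'p, 'b) fmap =
  OMap :: "'o \<Rightarrow> 'p"
  AMap :: "'a \<Rightarrow> 'b"

definition is_functor :: "('o, 'a) cat \<Rightarrow> ('p, 'b) cat \<Rightarrow> ('o, 'a, 'p, 'b) fmap \<Rightarrow> bool" where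
  "is_functor C D F \<longleftrightarrow> category C \<and> category D \<and>
     (\<forall>x \<in> Obj C. OMap F x \<in> Obj D \<and> AMap F (Ide C x) = Ide D (OMap F x)) \<and>
     (\<forall>f \<in> Arr C. AMap F f \<in> hom D (OMap F (Dom C f)) (OMap F (Cod C f))) \<and>
     (\<forall>f \<in> Arr C. \<forall>g \<in> Arr C. Dom C g = Cod C f \<longrightarrow>
        AMap F (g \<cdot>\<^bsub>C\<^esub> f) = AMap F g \<cdot>\<^bsub>D\<^esub> AMap F f)"

definition functor_eq ::
    "('o, 'a) cat \<Rightarrow> ('o, 'a, 'p, 'b) fmap \<Rightarrow> ('o, 'a, 'p, 'b) fmap \<Rightarrow> bool" where
  "functor_eq C F F' \<longleftrightarrow>
     (\<forall>x \<in> Obj C. OMap F x = OMap F' x) \<and> (\<forall>f \<in> Arr C. AMap F f = AMap F' f)"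

definition id_functor :: "('o, 'a, 'o, 'a) fmap" where
  "id_functor = \<lparr>OMap = (\<lambda>x. x), AMap = (\<lambda>f. f)\<rparr>"

definition comp_functor ::
    "('p, 'b, 'q, 'c) fmap \<Rightarrow> ('o, 'a, 'p, 'b) fmap \<Rightarrow> ('o, 'a, 'q, 'c) fmap"
    (infixl "\<cdot>\<^sub>F" 70) where
  "G \<cdot>\<^sub>F F = \<lparr>OMap = (\<lambda>x. OMap G (OMap F x)), AMap = (\<lambda>f. AMap G (AMap F f))\<rparr>"

definition nat_trans :: "('o, 'a) cat \<Rightarrow> ('p, 'b) cat \<Rightarrow> ('o, 'a, 'p, 'b) fmap \<Rightarrow>
    ('o, 'a, 'p, 'b) fmap \<Rightarrow> ('o \<Rightarrow> 'b) \<Rightarrow> bool" where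
  "nat_trans C D P P' \<tau> \<longleftrightarrow>
     (\<forall>x \<in> Obj C. \<tau> x \<in> hom D (OMap P x) (OMap P' x)) \<and>
     (\<forall>f \<in> Arr C. \<tau> (Cod C f) \<cdot>\<^bsub>D\<^esub> AMap P f = AMap P' f \<cdot>\<^bsub>D\<^esub> \<tau> (Dom C f))"

section \<open>Fibrations and opfibrations\<close>

text \<open>In what follows \<open>F\<close> is a functor from \<open>X\<close> to \<open>A\<close>.\<close>

definition vertical :: "('p, 'b) cat \<Rightarrow> ('o, 'a, 'p, 'b) fmap \<Rightarrow> 'a \<Rightarrow> bool" where
  "vertical A F f \<longleftrightarrow> (\<exists>a \<in> Obj A. AMap F f = Ide A a)"

definition cartesian ::
    "('o, 'a) cat \<Rightarrow> ('p, 'b) cat \<Rightarrow> ('o, 'a, 'p, 'b) fmap \<Rightarrow> 'a \<Rightarrow> bool" where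
  "cartesian X A F f \<longleftrightarrow> f \<in> Arr X \<and>
     (\<forall>g \<in> Arr X. \<forall>\<psi> \<in> hom A (OMap F (Dom X g)) (OMap F (Dom X f)).
        Cod X g = Cod X f \<longrightarrow> AMap F g = AMap F f \<cdot>\<^bsub>A\<^esub> \<psi> \<longrightarrow>
        (\<exists>!h. h \<in> hom X (Dom X g) (Dom X f) \<and> f \<cdot>\<^bsub>X\<^esub> h = g \<and> AMap F h = \<psi>))"

definition opcartesian ::
    "('o, 'a) cat \<Rightarrow> ('p, 'b) cat \<Rightarrow> ('o, 'a, 'p, 'b) fmap \<Rightarrow> 'a \<Rightarrow> bool" where
  "opcartesian X A F f \<longleftrightarrow> f \<in> Arr X \<and>
     (\<forall>g \<in> Arr X. \<forall>\<psi> \<in> hom A (OMap F (Cod X f)) (OMap F (Cod X g)).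
        Dom X g = Dom X f \<longrightarrow> AMap F g = \<psi> \<cdot>\<^bsub>A\<^esub> AMap F f \<longrightarrow>
        (\<exists>!h. h \<in> hom X (Cod X f) (Cod X g) \<and> h \<cdot>\<^bsub>X\<^esub> f = g \<and> AMap F h = \<psi>))"

definition cartesian_lifting ::
    "('o, 'a) cat \<Rightarrow> ('p, 'b) cat \<Rightarrow> ('o, 'a, 'p, 'b) fmap \<Rightarrow> 'b \<Rightarrow> 'o \<Rightarrow> 'a \<Rightarrow> bool" where
  "cartesian_lifting X A F \<alpha> x f \<longleftrightarrow> cartesian X A F f \<and> Cod X f = x \<and> AMap F f = \<alpha>"

definition opcartesian_lifting ::
    "('o, 'a) cat \<Rightarrow> ('p, 'b) cat \<Rightarrow> ('o, 'a, 'p, 'b) fmap \<Rightarrow> 'b \<Rightarrow> 'o \<Rightarrow> 'a \<Rightarrow> bool" where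
  "opcartesian_lifting X A F \<beta> x f \<longleftrightarrow> opcartesian X A F f \<and> Dom X f = x \<and> AMap F f = \<beta>"

text \<open>HOL has global choice, so existence of liftings already yields a cleavage.\<close>

definition fibration :: "('o, 'a) cat \<Rightarrow> ('p, 'b) cat \<Rightarrow> ('o, 'a, 'p, 'b) fmap \<Rightarrow> bool" where
  "fibration X A F \<longleftrightarrow> is_functor X A F \<and>
     (\<forall>x \<in> Obj X. \<forall>\<alpha> \<in> Arr A. Cod A \<alpha> = OMap F x \<longrightarrow> (\<exists>f. cartesian_lifting X A F \<alpha> x f))"

definition opfibration :: "('o, 'a) cat \<Rightarrow> ('p, 'b) cat \<Rightarrow> ('o, 'a, 'p, 'b) fmap \<Rightarrow> bool" where
  "opfibration X A F \<longleftrightarrow> is_functor X A F \<and>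
     (\<forall>x \<in> Obj X. \<forall>\<alpha> \<in> Arr A. Dom A \<alpha> = OMap F x \<longrightarrow> (\<exists>f. opcartesian_lifting X A F \<alpha> x f))"

section \<open>The 2-category Fib(A)\<close>

type_synonym ('o, 'a, 'p, 'b) over = "('o, 'a) cat \<times> ('o, 'a, 'p, 'b) fmap"

definition fib_obj :: "('p, 'b) cat \<Rightarrow> ('o, 'a, 'p, 'b) over \<Rightarrow> bool" where
  "fib_obj A = (\<lambda>(X, F). fibration X A F)"

definition fib_1cell :: "('p, 'b) cat \<Rightarrow> ('o, 'a, 'p, 'b) over \<Rightarrow> ('q, 'c, 'p, 'b) over \<Rightarrow>
    ('o, 'a, 'q, 'c) fmap \<Rightarrow> bool" where
  "fib_1cell A = (\<lambda>(X, F) (M, G) P.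
     fib_obj A (X, F) \<and> fib_obj A (M, G) \<and> is_functor X M P \<and>
     functor_eq X (G \<cdot>\<^sub>F P) F \<and>
     (\<forall>f. cartesian X A F f \<longrightarrow> cartesian M A G (AMap P f)))"

definition fib_2cell :: "('p, 'b) cat \<Rightarrow> ('o, 'a, 'p, 'b) over \<Rightarrow> ('q, 'c, 'p, 'b) over \<Rightarrow>
    ('o, 'a, 'q, 'c) fmap \<Rightarrow> ('o, 'a, 'q, 'c) fmap \<Rightarrow> ('o \<Rightarrow> 'c) \<Rightarrow> bool" where
  "fib_2cell A = (\<lambda>(X, F) (M, G) P P' \<tau>.
     fib_1cell A (X, F) (M, G) P \<and> fib_1cell A (X, F) (M, G) P' \<and>
     nat_trans X M P P' \<tau> \<and> (\<forall>x \<in> Obj X. vertical A G (\<tau> x)))"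

text \<open>\<open>L\<close> is left adjoint to \<open>R : (X, F) \<rightarrow> (Y, H)\<close> in Fib(A), with unit \<open>\<eta>\<close> and
  counit \<open>\<epsilon>\<close>.\<close>

definition fib_adjunction :: "('p, 'b) cat \<Rightarrow> ('o, 'a, 'p, 'b) over \<Rightarrow> ('q, 'c, 'p, 'b) over \<Rightarrow>
    ('q, 'c, 'o, 'a) fmap \<Rightarrow> ('o, 'a, 'q, 'c) fmap \<Rightarrow> ('q \<Rightarrow> 'c) \<Rightarrow> ('o \<Rightarrow> 'a) \<Rightarrow> bool" where
  "fib_adjunction A = (\<lambda>(X, F) (Y, H) L R \<eta> \<epsilon>.
     fib_1cell A (Y, H) (X, F) L \<and> fib_1cell A (X, F) (Y, H) R \<and>
     fib_2cell A (Y, H) (Y, H) id_functor (R \<cdot>\<^sub>F L) \<eta> \<and>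
     fib_2cell A (X, F) (X, F) (L \<cdot>\<^sub>F R) id_functor \<epsilon> \<and>
     (\<forall>y \<in> Obj Y. \<epsilon> (OMap L y) \<cdot>\<^bsub>X\<^esub> AMap L (\<eta> y) = Ide X (OMap L y)) \<and>
     (\<forall>x \<in> Obj X. AMap R (\<epsilon> x) \<cdot>\<^bsub>Y\<^esub> \<eta> (OMap R x) = Ide Y (OMap R x)))"

definition fib_has_left_adjoint_identity_unit :: "('p, 'b) cat \<Rightarrow> ('o, 'a, 'p, 'b) over \<Rightarrow>
    ('q, 'c, 'p, 'b) over \<Rightarrow> ('o, 'a, 'q, 'c) fmap \<Rightarrow> bool" where
  "fib_has_left_adjoint_identity_unit A = (\<lambda>(X, F) (Y, H) R.
     (\<exists>L \<eta> \<epsilon>. fib_adjunction A (X, F) (Y, H) L R \<eta> \<epsilon> \<and>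
        functor_eq Y (R \<cdot>\<^sub>F L) id_functor \<and> (\<forall>y \<in> Obj Y. \<eta> y = Ide Y y)))"

subsection \<open>Comma objects and opfibrations in Fib(A)\<close>

text \<open>The comma object of \<open>P : (X, F) \<rightarrow> (M, G)\<close> and \<open>Q : (Y, H) \<rightarrow> (M, G)\<close> in Fib(A),
  together with its functor to \<open>A\<close>.  An arrow is a pair \<open>(\<xi>, \<upsilon>)\<close> stored between its
  source and its target, so that domain and codomain can be read off.\<close>

definition fib_comma :: "('p, 'b) cat \<Rightarrow> ('o, 'a, 'p, 'b) over \<Rightarrow> ('r, 'd, 'p, 'b) over \<Rightarrow>
    ('q, 'c, 'p, 'b) over \<Rightarrow> ('o, 'a, 'q, 'c) fmap \<Rightarrow> ('r, 'd, 'q, 'c) fmap \<Rightarrow>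
    ('o \<times> 'c \<times> 'r, ('o \<times> 'c \<times> 'r) \<times> ('a \<times> 'd) \<times> ('o \<times> 'c \<times> 'r), 'p, 'b) over" where
  "fib_comma A = (\<lambda>(X, F) (Y, H) (M, G) P Q.
     (let obj = {(x, \<beta>, y). x \<in> Obj X \<and> y \<in> Obj Y \<and> \<beta> \<in> hom M (OMap P x) (OMap Q y) \<and>
                   AMap G \<beta> = Ide A (OMap F x)}
      in (\<lparr>Obj = obj,
           Arr = {((x, \<beta>, y), (\<xi>, \<upsilon>), (x', \<beta>', y')).
                    (x, \<beta>, y) \<in> obj \<and> (x', \<beta>', y') \<in> obj \<and>
                    \<xi> \<in> hom X x x' \<and> \<upsilon> \<in> hom Y y y' \<and>
                    \<beta>' \<cdot>\<^bsub>M\<^esub> AMap P \<xi> = AMap Q \<upsilon> \<cdot>\<^bsub>M\<^esub> \<beta>},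
           Dom = (\<lambda>(s, _, t). s),
           Cod = (\<lambda>(s, _, t). t),
           Ide = (\<lambda>(x, \<beta>, y). ((x, \<beta>, y), (Ide X x, Ide Y y), (x, \<beta>, y))),
           Comp = (\<lambda>(_, (\<xi>', \<upsilon>'), t') (s, (\<xi>, \<upsilon>), _). (s, (\<xi>' \<cdot>\<^bsub>X\<^esub> \<xi>, \<upsilon>' \<cdot>\<^bsub>Y\<^esub> \<upsilon>), t'))\<rparr>,
          \<lparr>OMap = (\<lambda>(x, _, _). OMap F x),
           AMap = (\<lambda>(_, (\<xi>, _), _). AMap F \<xi>)\<rparr>)))"

text \<open>The 1-cell induced by \<open>P\<close> applied to the universal 2-cell of the comma object of
  the identity of \<open>X\<close> with itself.\<close>

definition canonical_R :: "('o, 'a, 'q, 'c) fmap \<Rightarrow>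
    ('o \<times> 'a \<times> 'o, ('o \<times> 'a \<times> 'o) \<times> ('a \<times> 'a) \<times> ('o \<times> 'a \<times> 'o),
     'o \<times> 'c \<times> 'q, ('o \<times> 'c \<times> 'q) \<times> ('a \<times> 'c) \<times> ('o \<times> 'c \<times> 'q)) fmap" where
  "canonical_R P =
     (let r = (\<lambda>(x\<^sub>0, \<nu>, x\<^sub>1). (x\<^sub>0, AMap P \<nu>, OMap P x\<^sub>1))
      in \<lparr>OMap = r, AMap = (\<lambda>(s, (\<xi>\<^sub>0, \<xi>\<^sub>1), t). (r s, (\<xi>\<^sub>0, AMap P \<xi>\<^sub>1), r t))\<rparr>)"

definition opfibration_in_Fib :: "('p, 'b) cat \<Rightarrow> ('o, 'a, 'p, 'b) over \<Rightarrow>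
    ('q, 'c, 'p, 'b) over \<Rightarrow> ('o, 'a, 'q, 'c) fmap \<Rightarrow> bool" where
  "opfibration_in_Fib A = (\<lambda>(X, F) (M, G) P.
     fib_1cell A (X, F) (M, G) P \<and>
     fib_has_left_adjoint_identity_unit A
       (fib_comma A (X, F) (X, F) (X, F) id_functor id_functor)
       (fib_comma A (X, F) (M, G) (M, G) P id_functor)
       (canonical_R P))"

section \<open>Fiberwise opfibrations and the canonical comparison\<close>

text \<open>An arrow over \<open>Ide A a\<close> automatically has domain and codomain over \<open>a\<close>.\<close>

definition fiber :: "('p, 'b) cat \<Rightarrow> ('o, 'a, 'p, 'b) over \<Rightarrow> 'p \<Rightarrow> ('o, 'a) cat" where
  "fiber A = (\<lambda>(X, F) a.
     X\<lparr>Obj := {x \<in> Obj X. OMap F x = a}, Arr := {f \<in> Arr X. AMap F f = Ide A a}\<rparr>)"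

text \<open>The restriction of \<open>P\<close> to the fibers over \<open>a\<close> has the same underlying maps as \<open>P\<close>;
  only the source and target categories change.\<close>

definition fiberwise_opfibration :: "('p, 'b) cat \<Rightarrow> ('o, 'a, 'p, 'b) over \<Rightarrow>
    ('q, 'c, 'p, 'b) over \<Rightarrow> ('o, 'a, 'q, 'c) fmap \<Rightarrow> bool" where
  "fiberwise_opfibration A = (\<lambda>(X, F) (M, G) P.
     fib_1cell A (X, F) (M, G) P \<and>
     (\<forall>a \<in> Obj A. opfibration (fiber A (X, F) a) (fiber A (M, G) a) P))"

definition globally_opcartesian_liftings :: "('p, 'b) cat \<Rightarrow> ('o, 'a, 'p, 'b) over \<Rightarrow>
    ('q, 'c, 'p, 'b) over \<Rightarrow> ('o, 'a, 'q, 'c) fmap \<Rightarrow> bool" where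
  "globally_opcartesian_liftings A = (\<lambda>(X, F) (M, G) P.
     (\<forall>a \<in> Obj A. \<forall>f. opcartesian (fiber A (X, F) a) (fiber A (M, G) a) P f \<longrightarrow>
        opcartesian X M P f))"

text \<open>\<open>\<alpha>\<^sup>*(b)\<close>, where \<open>b : x \<rightarrow> y\<close> is vertical and \<open>c\<close>, \<open>c'\<close> are cartesian liftings of
  \<open>\<alpha>\<close> at \<open>x\<close> and at \<open>y\<close>.\<close>

definition reindex :: "('p, 'b) cat \<Rightarrow> ('o, 'a, 'p, 'b) over \<Rightarrow> 'a \<Rightarrow> 'a \<Rightarrow> 'a \<Rightarrow> 'a" where
  "reindex A = (\<lambda>(X, F) c c' b.
     (THE v. v \<in> hom X (Dom X c) (Dom X c') \<and> vertical A F v \<and> c' \<cdot>\<^bsub>X\<^esub> v = b \<cdot>\<^bsub>X\<^esub> c))"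

text \<open>A choice of the four liftings entering the construction of \<open>\<omega>\<close>:
  \<open>b\<close> is the opcartesian lifting of \<open>\<beta>\<close> at \<open>x\<close>, with codomain \<open>\<beta>\<^sub>*x\<close>;
  \<open>c\<close> and \<open>c'\<close> are the cartesian liftings of \<open>\<alpha>\<close> at \<open>x\<close> and at \<open>\<beta>\<^sub>*x\<close>;
  \<open>d\<close> is the opcartesian lifting of \<open>P(\<alpha>\<^sup>*b)\<close> at \<open>\<alpha>\<^sup>*x\<close>.\<close>

definition comparison_liftings :: "('p, 'b) cat \<Rightarrow> ('o, 'a, 'p, 'b) over \<Rightarrow>
    ('q, 'c, 'p, 'b) over \<Rightarrow> ('o, 'a, 'q, 'c) fmap \<Rightarrow> 'o \<Rightarrow> 'b \<Rightarrow> 'c \<Rightarrow>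
    'a \<Rightarrow> 'a \<Rightarrow> 'a \<Rightarrow> 'a \<Rightarrow> bool" where
  "comparison_liftings A = (\<lambda>(X, F) (M, G) P x \<alpha> \<beta> b c c' d.
     opcartesian_lifting (fiber A (X, F) (OMap F x)) (fiber A (M, G) (OMap F x)) P \<beta> x b \<and>
     cartesian_lifting X A F \<alpha> x c \<and>
     cartesian_lifting X A F \<alpha> (Cod X b) c' \<and>
     opcartesian_lifting (fiber A (X, F) (Dom A \<alpha>)) (fiber A (M, G) (Dom A \<alpha>)) P
       (AMap P (reindex A (X, F) c c' b)) (Dom X c) d)"

definition comparison :: "('p, 'b) cat \<Rightarrow> ('o, 'a, 'p, 'b) over \<Rightarrow> ('q, 'c, 'p, 'b) over \<Rightarrow>
    ('o, 'a, 'q, 'c) fmap \<Rightarrow> 'a \<Rightarrow> 'a \<Rightarrow> 'a \<Rightarrow> 'a \<Rightarrow> 'a" where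
  "comparison A = (\<lambda>(X, F) (M, G) P b c c' d.
     (THE \<omega>. \<omega> \<in> hom X (Cod X d) (Dom X c') \<and> vertical M P \<omega> \<and>
             \<omega> \<cdot>\<^bsub>X\<^esub> d = reindex A (X, F) c c' b))"

text \<open>Liftings are unique up to isomorphism, so whether \<open>\<omega>\<close> is invertible does not
  depend on their choice; the condition is stated for every choice.\<close>

definition comparison_iso :: "('p, 'b) cat \<Rightarrow> ('o, 'a, 'p, 'b) over \<Rightarrow> ('q, 'c, 'p, 'b) over \<Rightarrow>
    ('o, 'a, 'q, 'c) fmap \<Rightarrow> 'o \<Rightarrow> 'b \<Rightarrow> 'c \<Rightarrow> bool" where
  "comparison_iso A = (\<lambda>(X, F) (M, G) P x \<alpha> \<beta>.
     (\<forall>b c c' d. comparison_liftings A (X, F) (M, G) P x \<alpha> \<beta> b c c' d \<longrightarrow>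
        iso X (comparison A (X, F) (M, G) P b c c' d)))"

end

theory Submission
  imports Defs
begin

text \<open>
  Write \<open>X, M\<close> for the two total categories, \<open>F, G\<close> for their fibrations over \<open>A\<close>.
  Each of the three conditions amounts to the same pair of properties of \<open>P\<close>:

  \<^item> every \<open>\<beta> : P x \<rightarrow> m\<close> with \<open>G \<beta>\<close> an identity has a \<open>P\<close>-opcartesian lifting at \<open>x\<close>
    (\<open>has_vertical_opliftings\<close>);

  \<^item> if \<open>b\<close> is vertical and \<open>P\<close>-opcartesian, then so is every reindexing \<open>\<alpha>\<^sup>*b\<close>
    (\<open>reindexing_preserves_opcartesian\<close>).

  \<^bold>\<open>Conditions (II) and (III).\<close>  A vertical arrow that is opcartesian in its fiber is opcartesian for
  \<open>P\<close> on the whole of \<open>X\<close> (\<open>fiber_opcartesianD\<close>): an arrow \<open>g\<close> out of its source factors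
  through an \<open>F\<close>-cartesian \<open>c\<close> as a vertical arrow followed by \<open>c\<close>; since \<open>P c\<close> is
  \<open>G\<close>-cartesian, the factorization of \<open>P g\<close> in \<open>M\<close> can be pulled back to the fiber as well, and
  there the universal property applies.  So liftings in the fibers are always global, which makes (II) and
  (III) equivalent, and the fibers can be forgotten: a fiberwise opfibration is exactly a
  morphism with the first property (\<open>fiberwise_opfibration_iff\<close>).  The canonical comparison
  \<open>\<omega>\<close> is \<open>P\<close>-vertical and satisfies \<open>\<omega> \<cdot> d = \<alpha>\<^sup>*b\<close> with \<open>d\<close> opcartesian, so it is invertible if and only if
  \<open>\<alpha>\<^sup>*b\<close> is opcartesian (\<open>comparison_iso_iff_opcartesian\<close>); given the first property, the condition on
  comparisons is therefore the second one (\<open>comparison_iso_iff\<close>).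

  \<^bold>\<open>Condition (I).\<close>  A left adjoint of \<open>R\<close> in Fib(A) with identity unit is the same as a choice,
  for each object \<open>s\<close> of the target of \<open>R\<close>, of an object \<open>L s\<close> with \<open>R (L s) = s\<close> such that every
  arrow \<open>s \<rightarrow> R c\<close> comes from a unique arrow \<open>L s \<rightarrow> c\<close>, subject to the requirement that the
  arrow \<open>L s \<rightarrow> L s'\<close> over a cartesian arrow \<open>s \<rightarrow> s'\<close> is cartesian.  For the
  canonical \<open>R\<close> into the comma object, such an \<open>L (x, \<beta>, m)\<close> is precisely a \<open>P\<close>-opcartesian
  lifting of \<open>\<beta>\<close> at \<open>x\<close> (\<open>universal_over_iff_opcartesian\<close>), so the choice exists if and only if the first property
  holds.  Cartesian arrows of a comma object are those with two cartesian components.  Over a cartesian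
  arrow \<open>(c, \<mu>)\<close> of the comma object, with \<open>c\<close> over \<open>\<alpha>\<close>, lies a square \<open>(c, h)\<close> between two chosen liftings \<open>b'\<close>
  and \<open>b\<close>.  Factoring \<open>h\<close> through a cartesian lifting of \<open>\<alpha>\<close> leaves a vertical arrow \<open>i\<close> with
  \<open>i \<cdot> b' = \<alpha>\<^sup>*b\<close>, and \<open>h\<close> is cartesian if and only if \<open>i\<close> is invertible.  Since \<open>P i\<close> is invertible
  and \<open>b'\<close> is opcartesian, that holds if and only if \<open>\<alpha>\<^sup>*b\<close> is opcartesian, which is the second property.
\<close>

section \<open>Arrows in categories and under functors\<close>

lemma in_hom_arr: "f \<in> hom C x y \<Longrightarrow> f \<in> Arr C"
  and in_hom_dom: "f \<in> hom C x y \<Longrightarrow> Dom C f = x"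
  and in_hom_cod: "f \<in> hom C x y \<Longrightarrow> Cod C f = y"
  and arr_in_hom: "f \<in> Arr C \<Longrightarrow> f \<in> hom C (Dom C f) (Cod C f)"
  by (auto simp: hom_def)

lemma hom_obj:
  assumes "category C" and "f \<in> hom C x y"
  shows "x \<in> Obj C" and "y \<in> Obj C"
  using assms by (auto simp: category_def hom_def)

lemma comp_in_hom:
  assumes "category C" and "f \<in> hom C x y" and "g \<in> hom C y z"
  shows "g \<cdot>\<^bsub>C\<^esub> f \<in> hom C x z"
  using assms by (auto simp: category_def hom_def)

lemma comp_assoc:
  assumes "category C" and "f \<in> hom C w x" and "g \<in> hom C x y" and "h \<in> hom C y z"
  shows "(h \<cdot>\<^bsub>C\<^esub> g) \<cdot>\<^bsub>C\<^esub> f = h \<cdot>\<^bsub>C\<^esub> (g \<cdot>\<^bsub>C\<^esub> f)"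
  using assms by (auto simp: category_def hom_def)

lemma ide_in_hom: "category C \<Longrightarrow> x \<in> Obj C \<Longrightarrow> Ide C x \<in> hom C x x"
  by (auto simp: category_def)

lemma comp_ide: "category C \<Longrightarrow> f \<in> hom C x y \<Longrightarrow> f \<cdot>\<^bsub>C\<^esub> Ide C x = f"
  and ide_comp: "category C \<Longrightarrow> f \<in> hom C x y \<Longrightarrow> Ide C y \<cdot>\<^bsub>C\<^esub> f = f"
  by (auto simp: category_def hom_def)

lemma ide_inj:
  assumes "category C" and "x \<in> Obj C" and "Ide C x \<in> hom C y z"
  shows "y = x" and "z = x"
  using ide_in_hom[OF assms(1,2)] assms(3) by (auto simp: hom_def)

lemma isoI:
  assumes "f \<in> hom C x y" and "g \<in> hom C y x"
    and "g \<cdot>\<^bsub>C\<^esub> f = Ide C x" and "f \<cdot>\<^bsub>C\<^esub> g = Ide C y"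
  shows "iso C f"
  using assms by (auto simp: iso_def hom_def)

lemma isoE:
  assumes "iso C f" and "f \<in> hom C x y"
  obtains g where "g \<in> hom C y x" "g \<cdot>\<^bsub>C\<^esub> f = Ide C x" "f \<cdot>\<^bsub>C\<^esub> g = Ide C y"
  using assms by (auto simp: iso_def hom_def)

lemma iso_ide: "category C \<Longrightarrow> x \<in> Obj C \<Longrightarrow> iso C (Ide C x)"
  by (meson comp_ide ide_in_hom isoI)

lemma functor_dom: "is_functor C D F \<Longrightarrow> category C"
  and functor_cod: "is_functor C D F \<Longrightarrow> category D"
  by (auto simp: is_functor_def)

lemma functor_obj: "is_functor C D F \<Longrightarrow> x \<in> Obj C \<Longrightarrow> OMap F x \<in> Obj D"
  and functor_ide: "is_functor C D F \<Longrightarrow> x \<in> Obj C \<Longrightarrow> AMap F (Ide C x) = Ide D (OMap F x)"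
  by (auto simp: is_functor_def)

lemma functor_hom:
  "is_functor C D F \<Longrightarrow> f \<in> hom C x y \<Longrightarrow> AMap F f \<in> hom D (OMap F x) (OMap F y)"
  by (auto simp: is_functor_def hom_def)

lemma functor_comp:
  "is_functor C D F \<Longrightarrow> f \<in> hom C x y \<Longrightarrow> g \<in> hom C y z \<Longrightarrow>
    AMap F (g \<cdot>\<^bsub>C\<^esub> f) = AMap F g \<cdot>\<^bsub>D\<^esub> AMap F f"
  by (auto simp: is_functor_def hom_def)

lemma functorI:
  assumes "category C" and "category D"
    and "\<And>x. x \<in> Obj C \<Longrightarrow> OMap F x \<in> Obj D"
    and "\<And>x. x \<in> Obj C \<Longrightarrow> AMap F (Ide C x) = Ide D (OMap F x)"
    and "\<And>f x y. f \<in> hom C x y \<Longrightarrow> AMap F f \<in> hom D (OMap F x) (OMap F y)"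
    and "\<And>f g x y z. f \<in> hom C x y \<Longrightarrow> g \<in> hom C y z \<Longrightarrow>
      AMap F (g \<cdot>\<^bsub>C\<^esub> f) = AMap F g \<cdot>\<^bsub>D\<^esub> AMap F f"
  shows "is_functor C D F"
  unfolding is_functor_def using assms by (auto simp: hom_def)

lemma vertical_hom:
  assumes "is_functor X A F" and "f \<in> hom X x y" and "vertical A F f"
  shows "AMap F f = Ide A (OMap F x)" and "OMap F y = OMap F x"
proof -
  obtain a where a: "a \<in> Obj A" "AMap F f = Ide A a"
    using assms(3) by (auto simp: vertical_def)
  have "Ide A a \<in> hom A (OMap F x) (OMap F y)"
    using functor_hom[OF assms(1,2)] a by simp
  from ide_inj[OF functor_cod[OF assms(1)] a(1) this] a
  show "AMap F f = Ide A (OMap F x)" and "OMap F y = OMap F x" by auto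
qed

lemma verticalI: "a \<in> Obj A \<Longrightarrow> AMap F f = Ide A a \<Longrightarrow> vertical A F f"
  by (auto simp: vertical_def)

lemma vertical_iff:
  assumes "is_functor X A F" and "f \<in> hom X x y"
  shows "vertical A F f \<longleftrightarrow> AMap F f = Ide A (OMap F x)"
  using vertical_hom(1)[OF assms] functor_obj[OF assms(1) hom_obj(1)[OF functor_dom[OF assms(1)] assms(2)]]
  by (auto simp: vertical_def)

section \<open>Cartesian and opcartesian arrows\<close>

lemma cartesianI:
  assumes "f \<in> hom X x y"
    and "\<And>g z \<psi>. g \<in> hom X z y \<Longrightarrow> \<psi> \<in> hom A (OMap F z) (OMap F x) \<Longrightarrow>
      AMap F g = AMap F f \<cdot>\<^bsub>A\<^esub> \<psi> \<Longrightarrow>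
      \<exists>!h. h \<in> hom X z x \<and> f \<cdot>\<^bsub>X\<^esub> h = g \<and> AMap F h = \<psi>"
  shows "cartesian X A F f"
  using assms by (simp add: cartesian_def hom_def)

lemma cartesian_arr: "cartesian X A F f \<Longrightarrow> f \<in> hom X (Dom X f) (Cod X f)"
  by (auto simp: cartesian_def hom_def)

lemma cartesian_unique_factor:
  assumes "cartesian X A F f" and "f \<in> hom X x y" and "g \<in> hom X z y"
    and "\<psi> \<in> hom A (OMap F z) (OMap F x)" and "AMap F g = AMap F f \<cdot>\<^bsub>A\<^esub> \<psi>"
  shows "\<exists>!h. h \<in> hom X z x \<and> f \<cdot>\<^bsub>X\<^esub> h = g \<and> AMap F h = \<psi>"
  using assms(1)[unfolded cartesian_def, THEN conjunct2, rule_format, of g \<psi>] assms(2-)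
  by (simp add: in_hom_arr in_hom_dom in_hom_cod)

lemma cartesian_factor:
  assumes "cartesian X A F f" and "f \<in> hom X x y" and "g \<in> hom X z y"
    and "\<psi> \<in> hom A (OMap F z) (OMap F x)" and "AMap F g = AMap F f \<cdot>\<^bsub>A\<^esub> \<psi>"
  obtains h where "h \<in> hom X z x" "f \<cdot>\<^bsub>X\<^esub> h = g" "AMap F h = \<psi>"
  using cartesian_unique_factor[OF assms] by blast

lemma cartesian_cancel:
  assumes "is_functor X A F" and "cartesian X A F f" and "f \<in> hom X x y"
    and "h \<in> hom X z x" and "h' \<in> hom X z x"
    and "f \<cdot>\<^bsub>X\<^esub> h = f \<cdot>\<^bsub>X\<^esub> h'" and "AMap F h = AMap F h'"
  shows "h = h'"
proof -
  have "f \<cdot>\<^bsub>X\<^esub> h \<in> hom X z y"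
    using comp_in_hom[OF functor_dom[OF assms(1)] assms(4,3)] .
  from cartesian_unique_factor[OF assms(2,3) this functor_hom[OF assms(1,4)]
      functor_comp[OF assms(1,4,3)]]
  show ?thesis using assms by metis
qed

lemma cartesian_comp:
  assumes F: "is_functor X A F"
    and f: "cartesian X A F f" "f \<in> hom X x y" and g: "cartesian X A F g" "g \<in> hom X y z"
  shows "cartesian X A F (g \<cdot>\<^bsub>X\<^esub> f)"
proof (rule cartesianI)
  note X = functor_dom[OF F] and A = functor_cod[OF F]
  show gf: "g \<cdot>\<^bsub>X\<^esub> f \<in> hom X x z" using comp_in_hom[OF X f(2) g(2)] .
  fix k w \<psi>
  assume k: "k \<in> hom X w z" and \<psi>: "\<psi> \<in> hom A (OMap F w) (OMap F x)"
    and eq: "AMap F k = AMap F (g \<cdot>\<^bsub>X\<^esub> f) \<cdot>\<^bsub>A\<^esub> \<psi>"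
  note Ff = functor_hom[OF F f(2)] and Fg = functor_hom[OF F g(2)]
  have "AMap F k = AMap F g \<cdot>\<^bsub>A\<^esub> (AMap F f \<cdot>\<^bsub>A\<^esub> \<psi>)"
    using eq functor_comp[OF F f(2) g(2)] comp_assoc[OF A \<psi> Ff Fg] by simp
  then obtain l where l: "l \<in> hom X w y" "g \<cdot>\<^bsub>X\<^esub> l = k" "AMap F l = AMap F f \<cdot>\<^bsub>A\<^esub> \<psi>"
    using cartesian_factor[OF g k comp_in_hom[OF A \<psi> Ff]] by blast
  obtain h where h: "h \<in> hom X w x" "f \<cdot>\<^bsub>X\<^esub> h = l" "AMap F h = \<psi>"
    using cartesian_factor[OF f l(1) \<psi> l(3)] by blast
  show "\<exists>!h. h \<in> hom X w x \<and> (g \<cdot>\<^bsub>X\<^esub> f) \<cdot>\<^bsub>X\<^esub> h = k \<and> AMap F h = \<psi>"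
  proof (rule ex1I[of _ h])
    show "h \<in> hom X w x \<and> (g \<cdot>\<^bsub>X\<^esub> f) \<cdot>\<^bsub>X\<^esub> h = k \<and> AMap F h = \<psi>"
      using h l comp_assoc[OF X h(1) f(2) g(2)] by simp
    fix h' assume h': "h' \<in> hom X w x \<and> (g \<cdot>\<^bsub>X\<^esub> f) \<cdot>\<^bsub>X\<^esub> h' = k \<and> AMap F h' = \<psi>"
    then have "g \<cdot>\<^bsub>X\<^esub> (f \<cdot>\<^bsub>X\<^esub> h') = g \<cdot>\<^bsub>X\<^esub> l"
      using l comp_assoc[OF X _ f(2) g(2)] by metis
    then have "f \<cdot>\<^bsub>X\<^esub> h' = l"
      using cartesian_cancel[OF F g comp_in_hom[OF X _ f(2)] l(1)] h' l(3)
        functor_comp[OF F _ f(2)] by metis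
    then show "h' = h"
      using cartesian_cancel[OF F f _ h(1)] h h' by metis
  qed
qed

lemma iso_cartesian:
  assumes F: "is_functor X A F" and i: "iso X i"
  shows "cartesian X A F i"
proof -
  note X = functor_dom[OF F] and A = functor_cod[OF F]
  let ?x = "Dom X i" and ?y = "Cod X i"
  have i1: "i \<in> hom X ?x ?y" using i by (simp add: iso_def arr_in_hom)
  obtain j where j: "j \<in> hom X ?y ?x" "j \<cdot>\<^bsub>X\<^esub> i = Ide X ?x" "i \<cdot>\<^bsub>X\<^esub> j = Ide X ?y"
    using isoE[OF i i1] .
  show ?thesis
  proof (rule cartesianI[OF i1])
    fix g z \<psi>
    assume g: "g \<in> hom X z ?y" and \<psi>: "\<psi> \<in> hom A (OMap F z) (OMap F ?x)"
      and eq: "AMap F g = AMap F i \<cdot>\<^bsub>A\<^esub> \<psi>"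
    have jg: "j \<cdot>\<^bsub>X\<^esub> g \<in> hom X z ?x" using comp_in_hom[OF X g j(1)] .
    have "AMap F (j \<cdot>\<^bsub>X\<^esub> g) = (AMap F j \<cdot>\<^bsub>A\<^esub> AMap F i) \<cdot>\<^bsub>A\<^esub> \<psi>"
      using eq functor_comp[OF F g j(1)]
        comp_assoc[OF A \<psi> functor_hom[OF F i1] functor_hom[OF F j(1)]] by simp
    also have "\<dots> = \<psi>"
      using functor_comp[OF F i1 j(1)] j(2) functor_ide[OF F] hom_obj[OF X i1] ide_comp[OF A \<psi>]
      by simp
    finally have F1: "AMap F (j \<cdot>\<^bsub>X\<^esub> g) = \<psi>" .
    have F2: "i \<cdot>\<^bsub>X\<^esub> (j \<cdot>\<^bsub>X\<^esub> g) = g"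
      using comp_assoc[OF X g j(1) i1] j(3) ide_comp[OF X g] by simp
    show "\<exists>!h. h \<in> hom X z ?x \<and> i \<cdot>\<^bsub>X\<^esub> h = g \<and> AMap F h = \<psi>"
    proof (rule ex1I[of _ "j \<cdot>\<^bsub>X\<^esub> g"])
      fix h assume h: "h \<in> hom X z ?x \<and> i \<cdot>\<^bsub>X\<^esub> h = g \<and> AMap F h = \<psi>"
      then show "h = j \<cdot>\<^bsub>X\<^esub> g"
        using comp_assoc[OF X _ i1 j(1)] j(2) ide_comp[OF X] by metis
    qed (simp add: jg F1 F2)
  qed
qed

text \<open>Two cartesian arrows over isomorphic bases differ by an isomorphism: inverting \<open>F i\<close> gives a
  factorization of \<open>f'\<close> through \<open>f\<close>, and both composites with \<open>i\<close> are identities by cancellation.\<close>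

lemma iso_between_cartesian:
  assumes F: "is_functor X A F"
    and f: "cartesian X A F f" "f \<in> hom X x y" and f': "cartesian X A F f'" "f' \<in> hom X x' y"
    and i: "i \<in> hom X x x'" "f' \<cdot>\<^bsub>X\<^esub> i = f" and Fi: "iso A (AMap F i)"
  shows "iso X i"
proof -
  note X = functor_dom[OF F] and A = functor_cod[OF F]
  note Fi1 = functor_hom[OF F i(1)] and Ff' = functor_hom[OF F f'(2)]
  obtain k where k: "k \<in> hom A (OMap F x') (OMap F x)"
    "k \<cdot>\<^bsub>A\<^esub> AMap F i = Ide A (OMap F x)" "AMap F i \<cdot>\<^bsub>A\<^esub> k = Ide A (OMap F x')"
    using isoE[OF Fi Fi1] .
  have "AMap F f' = AMap F f \<cdot>\<^bsub>A\<^esub> k"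
    using functor_comp[OF F i(1) f'(2)] i(2) comp_assoc[OF A k(1) Fi1 Ff'] k(3)
      comp_ide[OF A Ff'] by simp
  then obtain j where j: "j \<in> hom X x' x" "f \<cdot>\<^bsub>X\<^esub> j = f'" "AMap F j = k"
    using cartesian_factor[OF f f'(2) k(1)] by blast
  note x = hom_obj[OF X f(2)] hom_obj[OF X f'(2)]
  have "i \<cdot>\<^bsub>X\<^esub> j = Ide X x'"
    using comp_assoc[OF X j(1) i(1) f'(2)] i(2) j(2) comp_ide[OF X f'(2)]
      functor_comp[OF F j(1) i(1)] j(3) k(3) functor_ide[OF F x(3)]
    by (intro cartesian_cancel[OF F f' comp_in_hom[OF X j(1) i(1)] ide_in_hom[OF X x(3)]]) simp_all
  moreover have "j \<cdot>\<^bsub>X\<^esub> i = Ide X x"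
    using comp_assoc[OF X i(1) j(1) f(2)] i(2) j(2) comp_ide[OF X f(2)]
      functor_comp[OF F i(1) j(1)] j(3) k(2) functor_ide[OF F x(1)]
    by (intro cartesian_cancel[OF F f comp_in_hom[OF X i(1) j(1)] ide_in_hom[OF X x(1)]]) simp_all
  ultimately show ?thesis using isoI[OF i(1) j(1)] by blast
qed

text \<open>Opcartesian arrows are the cartesian arrows of the opposite functor, so that their closure properties
  need no second proof.\<close>

definition opposite :: "('o, 'a) cat \<Rightarrow> ('o, 'a) cat" where
  "opposite C = \<lparr>Obj = Obj C, Arr = Arr C, Dom = Cod C, Cod = Dom C, Ide = Ide C,
     Comp = (\<lambda>g f. f \<cdot>\<^bsub>C\<^esub> g)\<rparr>"

lemma opposite_simps [simp]:
  "Obj (opposite C) = Obj C" "Arr (opposite C) = Arr C" "Dom (opposite C) = Cod C"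
  "Cod (opposite C) = Dom C" "Ide (opposite C) = Ide C" "g \<cdot>\<^bsub>opposite C\<^esub> f = f \<cdot>\<^bsub>C\<^esub> g"
  "hom (opposite C) x y = hom C y x"
  by (auto simp: opposite_def hom_def)

lemma category_opposite: "category C \<Longrightarrow> category (opposite C)"
  unfolding category_def opposite_simps by (auto simp: hom_def)

lemma functor_opposite: "is_functor C D F \<Longrightarrow> is_functor (opposite C) (opposite D) F"
  unfolding is_functor_def opposite_simps by (auto simp: category_opposite)

lemma iso_opposite: "iso (opposite C) f = iso C f"
  by (auto simp: iso_def)

lemma opcartesian_opposite: "opcartesian X A F f = cartesian (opposite X) (opposite A) F f"
  by (simp add: opcartesian_def cartesian_def)

lemma opcartesianI:
  assumes "f \<in> hom X x y"
    and "\<And>g z \<psi>. g \<in> hom X x z \<Longrightarrow> \<psi> \<in> hom A (OMap F y) (OMap F z) \<Longrightarrow>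
      AMap F g = \<psi> \<cdot>\<^bsub>A\<^esub> AMap F f \<Longrightarrow>
      \<exists>!h. h \<in> hom X y z \<and> h \<cdot>\<^bsub>X\<^esub> f = g \<and> AMap F h = \<psi>"
  shows "opcartesian X A F f"
  using assms unfolding opcartesian_opposite by (intro cartesianI) simp_all

lemma opcartesian_arr: "opcartesian X A F f \<Longrightarrow> f \<in> hom X (Dom X f) (Cod X f)"
  by (auto simp: opcartesian_def hom_def)

lemma opcartesian_unique_factor:
  assumes "opcartesian X A F f" and "f \<in> hom X x y" and "g \<in> hom X x z"
    and "\<psi> \<in> hom A (OMap F y) (OMap F z)" and "AMap F g = \<psi> \<cdot>\<^bsub>A\<^esub> AMap F f"
  shows "\<exists>!h. h \<in> hom X y z \<and> h \<cdot>\<^bsub>X\<^esub> f = g \<and> AMap F h = \<psi>"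
  using cartesian_unique_factor[of "opposite X" "opposite A" F f y x g z \<psi>] assms
  by (simp add: opcartesian_opposite)

lemma opcartesian_factor:
  assumes "opcartesian X A F f" and "f \<in> hom X x y" and "g \<in> hom X x z"
    and "\<psi> \<in> hom A (OMap F y) (OMap F z)" and "AMap F g = \<psi> \<cdot>\<^bsub>A\<^esub> AMap F f"
  obtains h where "h \<in> hom X y z" "h \<cdot>\<^bsub>X\<^esub> f = g" "AMap F h = \<psi>"
  using opcartesian_unique_factor[OF assms] by blast

lemma opcartesian_cancel:
  assumes "is_functor X A F" and "opcartesian X A F f" and "f \<in> hom X x y"
    and "h \<in> hom X y z" and "h' \<in> hom X y z"
    and "h \<cdot>\<^bsub>X\<^esub> f = h' \<cdot>\<^bsub>X\<^esub> f" and "AMap F h = AMap F h'"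
  shows "h = h'"
  using cartesian_cancel[OF functor_opposite[OF assms(1)]] assms
  by (simp add: opcartesian_opposite)

lemma opcartesian_comp_iso:
  assumes "is_functor X A F"
    and "opcartesian X A F f" and "f \<in> hom X x y" and "iso X g" and "g \<in> hom X y z"
  shows "opcartesian X A F (g \<cdot>\<^bsub>X\<^esub> f)"
  using cartesian_comp[OF functor_opposite[OF assms(1)], of g z y f x]
    iso_cartesian[OF functor_opposite[OF assms(1)], of g] assms
  by (simp add: opcartesian_opposite iso_opposite)

lemma iso_between_opcartesian:
  assumes "is_functor X A F"
    and "opcartesian X A F f" and "f \<in> hom X x y" and "opcartesian X A F f'" and "f' \<in> hom X x y'"
    and "i \<in> hom X y y'" and "i \<cdot>\<^bsub>X\<^esub> f = f'" and "iso A (AMap F i)"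
  shows "iso X i"
  using iso_between_cartesian[OF functor_opposite[OF assms(1)], of f' y' x f y i] assms
  by (simp add: opcartesian_opposite iso_opposite)

section \<open>Fibrations and their morphisms\<close>

lemma fibration_functor: "fibration X A F \<Longrightarrow> is_functor X A F"
  by (simp add: fibration_def)

lemma fibration_lifting:
  assumes "fibration X A F" and "x \<in> Obj X" and "\<alpha> \<in> hom A a (OMap F x)"
  obtains f z where "f \<in> hom X z x" "cartesian X A F f" "AMap F f = \<alpha>" "OMap F z = a"
proof -
  obtain f where f: "cartesian X A F f" "Cod X f = x" "AMap F f = \<alpha>"
    using assms unfolding fibration_def cartesian_lifting_def hom_def by blast
  have f1: "f \<in> hom X (Dom X f) x" using cartesian_arr[OF f(1)] f(2) by simp
  moreover have "OMap F (Dom X f) = a"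
    using functor_hom[OF fibration_functor[OF assms(1)] f1] f(3) assms(3) by (auto simp: hom_def)
  ultimately show thesis using that f by blast
qed

lemma fib_1cellD:
  assumes "fib_1cell A (X, F) (M, G) P"
  shows fib_1cell_source: "fibration X A F"
    and fib_1cell_target: "fibration M A G"
    and fib_1cell_source_functor: "is_functor X A F"
    and fib_1cell_target_functor: "is_functor M A G"
    and fib_1cell_functor: "is_functor X M P"
    and fib_1cell_obj: "x \<in> Obj X \<Longrightarrow> OMap G (OMap P x) = OMap F x"
    and fib_1cell_arr: "f \<in> hom X x y \<Longrightarrow> AMap G (AMap P f) = AMap F f"
    and fib_1cell_cartesian: "cartesian X A F f \<Longrightarrow> cartesian M A G (AMap P f)"
  using assms
  by (auto simp: fib_1cell_def fib_obj_def functor_eq_def comp_functor_def hom_def fibration_def)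

lemma fib_1cellI:
  assumes "fibration X A F" and "fibration M A G" and "is_functor X M P"
    and "\<And>x. x \<in> Obj X \<Longrightarrow> OMap G (OMap P x) = OMap F x"
    and "\<And>f. f \<in> Arr X \<Longrightarrow> AMap G (AMap P f) = AMap F f"
    and "\<And>f. cartesian X A F f \<Longrightarrow> cartesian M A G (AMap P f)"
  shows "fib_1cell A (X, F) (M, G) P"
  using assms by (auto simp: fib_1cell_def fib_obj_def functor_eq_def comp_functor_def)

lemma id_functor_simps [simp]: "OMap id_functor x = x" "AMap id_functor f = f"
  by (simp_all add: id_functor_def)

lemma comp_functor_simps [simp]:
  "OMap (G \<cdot>\<^sub>F F) x = OMap G (OMap F x)" "AMap (G \<cdot>\<^sub>F F) f = AMap G (AMap F f)"
  by (simp_all add: comp_functor_def)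

lemma fib_1cell_id: "fibration X A F \<Longrightarrow> fib_1cell A (X, F) (X, F) id_functor"
  by (intro fib_1cellI functorI) (auto simp: fibration_def is_functor_def)

lemma fib_1cell_comp:
  assumes P: "fib_1cell A (X, F) (M, G) P" and Q: "fib_1cell A (M, G) (N, H) Q"
  shows "fib_1cell A (X, F) (N, H) (Q \<cdot>\<^sub>F P)"
proof (intro fib_1cellI functorI)
  note FP = fib_1cell_functor[OF P] and FQ = fib_1cell_functor[OF Q]
  show "fibration X A F" "fibration N A H"
    using fib_1cell_source[OF P] fib_1cell_target[OF Q] .
  show "category X" "category N" using functor_dom[OF FP] functor_cod[OF FQ] .
  show "OMap (Q \<cdot>\<^sub>F P) x \<in> Obj N" "AMap (Q \<cdot>\<^sub>F P) (Ide X x) = Ide N (OMap (Q \<cdot>\<^sub>F P) x)"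
    "OMap H (OMap (Q \<cdot>\<^sub>F P) x) = OMap F x" if "x \<in> Obj X" for x
    using that functor_obj[OF FP that] fib_1cell_obj[OF P] fib_1cell_obj[OF Q]
    by (simp_all add: functor_obj[OF FQ] functor_ide[OF FP] functor_ide[OF FQ])
  show "AMap (Q \<cdot>\<^sub>F P) f \<in> hom N (OMap (Q \<cdot>\<^sub>F P) x) (OMap (Q \<cdot>\<^sub>F P) y)" if "f \<in> hom X x y" for f x y
    using functor_hom[OF FQ functor_hom[OF FP that]] by simp
  show "AMap (Q \<cdot>\<^sub>F P) (g \<cdot>\<^bsub>X\<^esub> f) = AMap (Q \<cdot>\<^sub>F P) g \<cdot>\<^bsub>N\<^esub> AMap (Q \<cdot>\<^sub>F P) f"
    if "f \<in> hom X x y" "g \<in> hom X y z" for f g x y z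
    using functor_comp[OF FP that] functor_comp[OF FQ functor_hom[OF FP that(1)] functor_hom[OF FP that(2)]]
    by simp
  show "AMap H (AMap (Q \<cdot>\<^sub>F P) f) = AMap F f" if "f \<in> Arr X" for f
    using fib_1cell_arr[OF P arr_in_hom[OF that]]
      fib_1cell_arr[OF Q functor_hom[OF FP arr_in_hom[OF that]]] by simp
  show "cartesian N A H (AMap (Q \<cdot>\<^sub>F P) f)" if "cartesian X A F f" for f
    using fib_1cell_cartesian[OF Q fib_1cell_cartesian[OF P that]] by simp
qed

section \<open>Comma objects of fibrations\<close>

text \<open>The comma object is a parameter tied down by an equation, rather than a defined constant, so that the
  results apply both to \<open>X \<down> X\<close> and to \<open>P \<down> M\<close> as pairs of a category and its functor to \<open>A\<close>.\<close>

locale comma_in_Fib =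
  fixes A :: "('p, 'b) cat"
    and X :: "('o, 'a) cat" and F :: "('o, 'a, 'p, 'b) fmap"
    and Y :: "('r, 'd) cat" and H :: "('r, 'd, 'p, 'b) fmap"
    and M :: "('q, 'c) cat" and G :: "('q, 'c, 'p, 'b) fmap"
    and P :: "('o, 'a, 'q, 'c) fmap" and Q :: "('r, 'd, 'q, 'c) fmap"
    and K U
  assumes left: "fib_1cell A (X, F) (M, G) P"
    and right: "fib_1cell A (Y, H) (M, G) Q"
    and comma: "fib_comma A (X, F) (Y, H) (M, G) P Q = (K, U)"
begin

lemma K_def: "K = fst (fib_comma A (X, F) (Y, H) (M, G) P Q)"
  and U_def: "U = snd (fib_comma A (X, F) (Y, H) (M, G) P Q)"
  using comma by simp_all

lemma comma_obj:
  "(x, \<beta>, y) \<in> Obj K \<longleftrightarrow> x \<in> Obj X \<and> y \<in> Obj Y \<and> \<beta> \<in> hom M (OMap P x) (OMap Q y) \<and>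
    AMap G \<beta> = Ide A (OMap F x)"
  by (simp add: K_def fib_comma_def Let_def)

lemma comma_simps [simp]:
  "Dom K (s, k, t) = s" "Cod K (s, k, t) = t"
  "Ide K (x, \<beta>, y) = ((x, \<beta>, y), (Ide X x, Ide Y y), (x, \<beta>, y))"
  "(s', (\<xi>', \<upsilon>'), t') \<cdot>\<^bsub>K\<^esub> (s, (\<xi>, \<upsilon>), t) = (s, (\<xi>' \<cdot>\<^bsub>X\<^esub> \<xi>, \<upsilon>' \<cdot>\<^bsub>Y\<^esub> \<upsilon>), t')"
  "OMap U (x, \<beta>, y) = OMap F x" "AMap U (s, (\<xi>, \<upsilon>), t) = AMap F \<xi>"
  by (simp_all add: K_def U_def fib_comma_def Let_def split: prod.split)

lemma comma_hom:
  "(s, (\<xi>, \<upsilon>), t) \<in> hom K (x, \<beta>, y) (x', \<beta>', y') \<longleftrightarrow> s = (x, \<beta>, y) \<and> t = (x', \<beta>', y') \<and>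
    (x, \<beta>, y) \<in> Obj K \<and> (x', \<beta>', y') \<in> Obj K \<and> \<xi> \<in> hom X x x' \<and> \<upsilon> \<in> hom Y y y' \<and>
    \<beta>' \<cdot>\<^bsub>M\<^esub> AMap P \<xi> = AMap Q \<upsilon> \<cdot>\<^bsub>M\<^esub> \<beta>"
  by (auto simp: K_def fib_comma_def Let_def hom_def)

lemma comma_homE:
  assumes "k \<in> hom K s t"
  obtains x \<beta> y x' \<beta>' y' \<xi> \<upsilon> where "s = (x, \<beta>, y)" "t = (x', \<beta>', y')" "k = (s, (\<xi>, \<upsilon>), t)"
    "k \<in> hom K (x, \<beta>, y) (x', \<beta>', y')"
proof -
  obtain x \<beta> y x' \<beta>' y' s' \<xi> \<upsilon> t' where e: "s = (x, \<beta>, y)" "t = (x', \<beta>', y')" "k = (s', (\<xi>, \<upsilon>), t')"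
    by (metis prod.collapse)
  with assms show thesis using that by (simp add: comma_hom)
qed

lemmas X_cat = functor_dom[OF fib_1cell_functor[OF left]]
  and Y_cat = functor_dom[OF fib_1cell_functor[OF right]]
  and M_cat = functor_dom[OF fib_1cell_target_functor[OF left]]
  and A_cat = functor_cod[OF fib_1cell_target_functor[OF left]]
  and P_fun = fib_1cell_functor[OF left]
  and Q_fun = fib_1cell_functor[OF right]
  and F_fun = fib_1cell_source_functor[OF left]
  and H_fun = fib_1cell_source_functor[OF right]
  and G_fun = fib_1cell_target_functor[OF left]

lemma comma_obj_over:
  assumes "(x, \<beta>, y) \<in> Obj K"
  shows "OMap H y = OMap F x"
proof -
  have \<beta>: "\<beta> \<in> hom M (OMap P x) (OMap Q y)" "vertical A G \<beta>"
    using assms functor_obj[OF F_fun] by (auto simp: comma_obj vertical_def)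
  show ?thesis
    using vertical_hom(2)[OF G_fun \<beta>] assms
    by (simp add: comma_obj fib_1cell_obj[OF left] fib_1cell_obj[OF right])
qed

text \<open>The functor to \<open>A\<close> is read off the first component; the second one lies over the same arrow because
  \<open>G\<close> sends \<open>\<beta>\<close> and \<open>\<beta>'\<close> to identities.\<close>

lemma comma_arr_over:
  assumes "(s, (\<xi>, \<upsilon>), t) \<in> hom K (x, \<beta>, y) (x', \<beta>', y')"
  shows "AMap H \<upsilon> = AMap F \<xi>"
proof -
  note a = assms[unfolded comma_hom comma_obj]
  have 1: "\<beta> \<in> hom M (OMap P x) (OMap Q y)" "\<beta>' \<in> hom M (OMap P x') (OMap Q y')"
    "\<xi> \<in> hom X x x'" "\<upsilon> \<in> hom Y y y'" using a by auto
  have 2: "OMap H y = OMap F x" using comma_obj_over assms unfolding comma_hom by blast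
  have "AMap G \<beta>' \<cdot>\<^bsub>A\<^esub> AMap F \<xi> = AMap H \<upsilon> \<cdot>\<^bsub>A\<^esub> AMap G \<beta>"
    using a functor_comp[OF G_fun functor_hom[OF P_fun 1(3)] 1(2)]
      functor_comp[OF G_fun 1(1) functor_hom[OF Q_fun 1(4)]]
    by (simp add: fib_1cell_arr[OF left 1(3)] fib_1cell_arr[OF right 1(4)])
  then show ?thesis
    using a ide_comp[OF A_cat functor_hom[OF F_fun 1(3)]]
      comp_ide[OF A_cat functor_hom[OF H_fun 1(4)]] 2 by simp
qed

lemma comma_comp_in_hom:
  assumes "f \<in> hom K s t" and "g \<in> hom K t u"
  shows "g \<cdot>\<^bsub>K\<^esub> f \<in> hom K s u"
proof -
  obtain x \<beta> y x' \<beta>' y' \<xi> \<upsilon> where f: "s = (x, \<beta>, y)" "t = (x', \<beta>', y')" "f = (s, (\<xi>, \<upsilon>), t)"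
    "f \<in> hom K (x, \<beta>, y) (x', \<beta>', y')"
    by (rule comma_homE[OF assms(1)])
  obtain x'' \<beta>'' y'' \<xi>' \<upsilon>' where g: "u = (x'', \<beta>'', y'')" "g = (t, (\<xi>', \<upsilon>'), u)"
    "g \<in> hom K (x', \<beta>', y') (x'', \<beta>'', y'')"
    by (rule comma_homE[OF assms(2)]) (use f in auto)
  have f': "\<xi> \<in> hom X x x'" "\<upsilon> \<in> hom Y y y'" "\<beta>' \<cdot>\<^bsub>M\<^esub> AMap P \<xi> = AMap Q \<upsilon> \<cdot>\<^bsub>M\<^esub> \<beta>"
    "\<beta> \<in> hom M (OMap P x) (OMap Q y)" "\<beta>' \<in> hom M (OMap P x') (OMap Q y')"
    using f by (simp_all add: comma_hom comma_obj)
  have g': "\<xi>' \<in> hom X x' x''" "\<upsilon>' \<in> hom Y y' y''" "\<beta>'' \<cdot>\<^bsub>M\<^esub> AMap P \<xi>' = AMap Q \<upsilon>' \<cdot>\<^bsub>M\<^esub> \<beta>'"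
    "\<beta>'' \<in> hom M (OMap P x'') (OMap Q y'')"
    using g by (simp_all add: comma_hom comma_obj)
  note Pf = functor_hom[OF P_fun f'(1)] and Pg = functor_hom[OF P_fun g'(1)]
    and Qf = functor_hom[OF Q_fun f'(2)] and Qg = functor_hom[OF Q_fun g'(2)]
  have "\<beta>'' \<cdot>\<^bsub>M\<^esub> AMap P (\<xi>' \<cdot>\<^bsub>X\<^esub> \<xi>) = (\<beta>'' \<cdot>\<^bsub>M\<^esub> AMap P \<xi>') \<cdot>\<^bsub>M\<^esub> AMap P \<xi>"
    using functor_comp[OF P_fun f'(1) g'(1)] comp_assoc[OF M_cat Pf Pg g'(4)] by simp
  also have "\<dots> = AMap Q \<upsilon>' \<cdot>\<^bsub>M\<^esub> (\<beta>' \<cdot>\<^bsub>M\<^esub> AMap P \<xi>)"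
    using g'(3) comp_assoc[OF M_cat Pf f'(5) Qg] by simp
  also have "\<dots> = AMap Q (\<upsilon>' \<cdot>\<^bsub>Y\<^esub> \<upsilon>) \<cdot>\<^bsub>M\<^esub> \<beta>"
    using f'(3) comp_assoc[OF M_cat f'(4) Qf Qg] functor_comp[OF Q_fun f'(2) g'(2)] by simp
  finally have "\<beta>'' \<cdot>\<^bsub>M\<^esub> AMap P (\<xi>' \<cdot>\<^bsub>X\<^esub> \<xi>) = AMap Q (\<upsilon>' \<cdot>\<^bsub>Y\<^esub> \<upsilon>) \<cdot>\<^bsub>M\<^esub> \<beta>" .
  then show ?thesis
    using f g comp_in_hom[OF X_cat f'(1) g'(1)] comp_in_hom[OF Y_cat f'(2) g'(2)]
    by (simp add: comma_hom)
qed

lemma comma_ide_in_hom: 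
  assumes "s \<in> Obj K"
  shows "Ide K s \<in> hom K s s"
proof -
  obtain x \<beta> y where s: "s = (x, \<beta>, y)" by (metis prod.collapse)
  note a = assms[unfolded s comma_obj]
  then have \<beta>: "\<beta> \<in> hom M (OMap P x) (OMap Q y)" by simp
  show ?thesis
    using assms a comp_ide[OF M_cat \<beta>] ide_comp[OF M_cat \<beta>]
    by (simp add: s comma_hom ide_in_hom[OF X_cat] ide_in_hom[OF Y_cat] functor_ide[OF P_fun]
        functor_ide[OF Q_fun])
qed

lemma comma_category: "category K"
  unfolding category_def
proof (intro conjI ballI impI)
  fix f assume f: "f \<in> Arr K"
  obtain x \<beta> y x' \<beta>' y' \<xi> \<upsilon> where fe: "f = ((x, \<beta>, y), (\<xi>, \<upsilon>), (x', \<beta>', y'))"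
    "f \<in> hom K (x, \<beta>, y) (x', \<beta>', y')"
    by (rule comma_homE[OF arr_in_hom[OF f]]) auto
  then have f': "\<xi> \<in> hom X x x'" "\<upsilon> \<in> hom Y y y'" "(x, \<beta>, y) \<in> Obj K" "(x', \<beta>', y') \<in> Obj K"
    by (simp_all add: comma_hom)
  then show "Dom K f \<in> Obj K" "Cod K f \<in> Obj K" by (simp_all add: fe)
  show "f \<cdot>\<^bsub>K\<^esub> Ide K (Dom K f) = f" "Ide K (Cod K f) \<cdot>\<^bsub>K\<^esub> f = f"
    using f' by (simp_all add: fe(1) comp_ide[OF X_cat] comp_ide[OF Y_cat] ide_comp[OF X_cat]
        ide_comp[OF Y_cat])
  fix g assume g: "g \<in> Arr K" and gf: "Dom K g = Cod K f"
  show "g \<cdot>\<^bsub>K\<^esub> f \<in> hom K (Dom K f) (Cod K g)"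
    using comma_comp_in_hom[OF arr_in_hom[OF f]] arr_in_hom[OF g] gf by simp
  fix h assume h: "h \<in> Arr K" and hg: "Dom K h = Cod K g"
  have 1: "g \<in> hom K (x', \<beta>', y') (Cod K g)" using arr_in_hom[OF g] gf by (simp add: fe(1))
  obtain x'' \<beta>'' y'' \<xi>' \<upsilon>' where ge: "g = ((x', \<beta>', y'), (\<xi>', \<upsilon>'), (x'', \<beta>'', y''))"
    "g \<in> hom K (x', \<beta>', y') (x'', \<beta>'', y'')"
    by (rule comma_homE[OF 1]) auto
  have 2: "h \<in> hom K (x'', \<beta>'', y'') (Cod K h)" using arr_in_hom[OF h] hg by (simp add: ge(1))
  obtain x3 \<beta>3 y3 \<xi>'' \<upsilon>'' where he: "h = ((x'', \<beta>'', y''), (\<xi>'', \<upsilon>''), (x3, \<beta>3, y3))"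
    "h \<in> hom K (x'', \<beta>'', y'') (x3, \<beta>3, y3)"
    by (rule comma_homE[OF 2]) auto
  have "\<xi>' \<in> hom X x' x''" "\<upsilon>' \<in> hom Y y' y''" "\<xi>'' \<in> hom X x'' x3" "\<upsilon>'' \<in> hom Y y'' y3"
    using ge he by (simp_all add: comma_hom)
  then show "(h \<cdot>\<^bsub>K\<^esub> g) \<cdot>\<^bsub>K\<^esub> f = h \<cdot>\<^bsub>K\<^esub> (g \<cdot>\<^bsub>K\<^esub> f)"
    using f' by (simp add: fe(1) ge(1) he(1) comp_assoc[OF X_cat] comp_assoc[OF Y_cat])
qed (rule comma_ide_in_hom)

lemma comma_functor: "is_functor K A U"
proof (rule functorI[OF comma_category A_cat])
  show "OMap U s \<in> Obj A" "AMap U (Ide K s) = Ide A (OMap U s)" if "s \<in> Obj K" for s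
  proof -
    obtain x \<beta> y where s: "s = (x, \<beta>, y)" by (metis prod.collapse)
    show "OMap U s \<in> Obj A" "AMap U (Ide K s) = Ide A (OMap U s)" using that
      by (simp_all add: s comma_obj functor_ide[OF F_fun] functor_obj[OF F_fun])
  qed
  show "AMap U f \<in> hom A (OMap U s) (OMap U t)" if f: "f \<in> hom K s t" for f s t
    by (rule comma_homE[OF f]) (auto simp: comma_hom functor_hom[OF F_fun])
  show "AMap U (g \<cdot>\<^bsub>K\<^esub> f) = AMap U g \<cdot>\<^bsub>A\<^esub> AMap U f" if f: "f \<in> hom K s t" and g: "g \<in> hom K t u"
    for f g s t u
    by (rule comma_homE[OF f], rule comma_homE[OF g]) (auto simp: comma_hom functor_comp[OF F_fun])
qed

text \<open>Factorizations are found in each component separately.  They form an arrow of the comma object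
  because the required square commutes after composition with \<open>Q \<upsilon>\<close>, which is \<open>G\<close>-cartesian.\<close>

lemma comma_cartesianI:
  assumes k: "(s, (\<xi>, \<upsilon>), t) \<in> hom K s t"
    and \<xi>: "cartesian X A F \<xi>" and \<upsilon>: "cartesian Y A H \<upsilon>"
  shows "cartesian K A U (s, (\<xi>, \<upsilon>), t)"
proof (rule cartesianI[OF k])
  fix g r \<psi>
  assume g: "g \<in> hom K r t" and \<psi>: "\<psi> \<in> hom A (OMap U r) (OMap U s)"
    and eq: "AMap U g = AMap U (s, (\<xi>, \<upsilon>), t) \<cdot>\<^bsub>A\<^esub> \<psi>"
  obtain x \<beta> y x' \<beta>' y' where e: "s = (x, \<beta>, y)" "t = (x', \<beta>', y')"
    by (metis prod.collapse)
  obtain x0 \<beta>0 y0 \<xi>' \<upsilon>' where ge: "r = (x0, \<beta>0, y0)" "g = (r, (\<xi>', \<upsilon>'), t)"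
    by (rule comma_homE[OF g]) auto
  have k': "\<xi> \<in> hom X x x'" "\<upsilon> \<in> hom Y y y'" "\<beta>' \<cdot>\<^bsub>M\<^esub> AMap P \<xi> = AMap Q \<upsilon> \<cdot>\<^bsub>M\<^esub> \<beta>"
    "(x, \<beta>, y) \<in> Obj K" "(x', \<beta>', y') \<in> Obj K"
    "\<beta> \<in> hom M (OMap P x) (OMap Q y)" "\<beta>' \<in> hom M (OMap P x') (OMap Q y')"
    "AMap G \<beta> = Ide A (OMap F x)"
    using k unfolding e by (simp_all add: comma_hom comma_obj)
  have g': "\<xi>' \<in> hom X x0 x'" "\<upsilon>' \<in> hom Y y0 y'" "\<beta>' \<cdot>\<^bsub>M\<^esub> AMap P \<xi>' = AMap Q \<upsilon>' \<cdot>\<^bsub>M\<^esub> \<beta>0"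
    "(x0, \<beta>0, y0) \<in> Obj K" "\<beta>0 \<in> hom M (OMap P x0) (OMap Q y0)" "AMap G \<beta>0 = Ide A (OMap F x0)"
    using g unfolding e ge by (simp_all add: comma_hom comma_obj)
  note over = comma_obj_over[OF k'(4)] comma_obj_over[OF g'(4)]
  have \<psi>1: "\<psi> \<in> hom A (OMap F x0) (OMap F x)" using \<psi> by (simp add: e ge)
  have \<psi>2: "\<psi> \<in> hom A (OMap H y0) (OMap H y)" using \<psi>1 over by simp
  have eq1: "AMap F \<xi>' = AMap F \<xi> \<cdot>\<^bsub>A\<^esub> \<psi>" using eq by (simp add: ge)
  have eq2: "AMap H \<upsilon>' = AMap H \<upsilon> \<cdot>\<^bsub>A\<^esub> \<psi>"
    using eq1 comma_arr_over k g unfolding e ge by simp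
  obtain h1 where h1: "h1 \<in> hom X x0 x" "\<xi> \<cdot>\<^bsub>X\<^esub> h1 = \<xi>'" "AMap F h1 = \<psi>"
    using cartesian_factor[OF \<xi> k'(1) g'(1) \<psi>1 eq1] .
  obtain h2 where h2: "h2 \<in> hom Y y0 y" "\<upsilon> \<cdot>\<^bsub>Y\<^esub> h2 = \<upsilon>'" "AMap H h2 = \<psi>"
    using cartesian_factor[OF \<upsilon> k'(2) g'(2) \<psi>2 eq2] .
  note Ph1 = functor_hom[OF P_fun h1(1)] and Qh2 = functor_hom[OF Q_fun h2(1)]
    and P\<xi> = functor_hom[OF P_fun k'(1)] and Q\<upsilon> = functor_hom[OF Q_fun k'(2)]
  have "\<beta> \<cdot>\<^bsub>M\<^esub> AMap P h1 = AMap Q h2 \<cdot>\<^bsub>M\<^esub> \<beta>0"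
  proof (rule cartesian_cancel[OF G_fun fib_1cell_cartesian[OF right \<upsilon>] Q\<upsilon>
        comp_in_hom[OF M_cat Ph1 k'(6)] comp_in_hom[OF M_cat g'(5) Qh2]])
    have "AMap Q \<upsilon> \<cdot>\<^bsub>M\<^esub> (\<beta> \<cdot>\<^bsub>M\<^esub> AMap P h1) = \<beta>' \<cdot>\<^bsub>M\<^esub> AMap P \<xi>'"
      using comp_assoc[OF M_cat Ph1 k'(6) Q\<upsilon>] k'(3) comp_assoc[OF M_cat Ph1 P\<xi> k'(7)]
        functor_comp[OF P_fun h1(1) k'(1)] h1(2) by simp
    also have "\<dots> = AMap Q \<upsilon> \<cdot>\<^bsub>M\<^esub> (AMap Q h2 \<cdot>\<^bsub>M\<^esub> \<beta>0)"
      using comp_assoc[OF M_cat g'(5) Qh2 Q\<upsilon>] g'(3) functor_comp[OF Q_fun h2(1) k'(2)] h2(2) by simp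
    finally show "AMap Q \<upsilon> \<cdot>\<^bsub>M\<^esub> (\<beta> \<cdot>\<^bsub>M\<^esub> AMap P h1) = AMap Q \<upsilon> \<cdot>\<^bsub>M\<^esub> (AMap Q h2 \<cdot>\<^bsub>M\<^esub> \<beta>0)" .
    show "AMap G (\<beta> \<cdot>\<^bsub>M\<^esub> AMap P h1) = AMap G (AMap Q h2 \<cdot>\<^bsub>M\<^esub> \<beta>0)"
      using functor_comp[OF G_fun Ph1 k'(6)] functor_comp[OF G_fun g'(5) Qh2] k'(8) g'(6)
        fib_1cell_arr[OF left h1(1)] fib_1cell_arr[OF right h2(1)] h1(3) h2(3)
        ide_comp[OF A_cat \<psi>1] comp_ide[OF A_cat \<psi>1] by simp
  qed
  then have h: "(r, (h1, h2), s) \<in> hom K r s"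
    using k'(4) g'(4) h1(1) h2(1) by (simp add: comma_hom e ge)
  show "\<exists>!h. h \<in> hom K r s \<and> (s, (\<xi>, \<upsilon>), t) \<cdot>\<^bsub>K\<^esub> h = g \<and> AMap U h = \<psi>"
  proof (rule ex1I[of _ "(r, (h1, h2), s)"])
    show "(r, (h1, h2), s) \<in> hom K r s \<and> (s, (\<xi>, \<upsilon>), t) \<cdot>\<^bsub>K\<^esub> (r, (h1, h2), s) = g \<and>
      AMap U (r, (h1, h2), s) = \<psi>"
      using h h1 h2 by (simp add: ge)
    fix h' assume h': "h' \<in> hom K r s \<and> (s, (\<xi>, \<upsilon>), t) \<cdot>\<^bsub>K\<^esub> h' = g \<and> AMap U h' = \<psi>"
    then obtain h1' h2' where he: "h' = (r, (h1', h2'), s)"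
      by (metis comma_homE)
    have 1: "h1' \<in> hom X x0 x" "h2' \<in> hom Y y0 y" "AMap H h2' = AMap F h1'"
      using h' comma_arr_over unfolding he e ge by (auto simp: comma_hom)
    have 2: "AMap F h1' = \<psi>" "\<xi> \<cdot>\<^bsub>X\<^esub> h1' = \<xi>'" "\<upsilon> \<cdot>\<^bsub>Y\<^esub> h2' = \<upsilon>'" using h' by (simp_all add: he ge)
    have "h1' = h1"
      using cartesian_cancel[OF F_fun \<xi> k'(1) 1(1) h1(1)] 2 h1 by simp
    moreover have "h2' = h2"
      using cartesian_cancel[OF H_fun \<upsilon> k'(2) 1(2) h2(1)] 1 2 h2 by simp
    ultimately show "h' = (r, (h1, h2), s)" by (simp add: he)
  qed
qed

text \<open>The missing structure arrow \<open>\<beta>'\<close> is the vertical arrow obtained by factoring \<open>\<beta> \<cdot> P \<xi>\<close>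
  through the \<open>G\<close>-cartesian arrow \<open>Q \<upsilon>\<close>.\<close>

lemma comma_lifting:
  assumes t: "(x, \<beta>, y) \<in> Obj K"
    and c: "cartesian X A F \<xi>" "\<xi> \<in> hom X x' x"
    and c': "cartesian Y A H \<upsilon>" "\<upsilon> \<in> hom Y y' y" and eq: "AMap H \<upsilon> = AMap F \<xi>"
  obtains \<beta>' where "((x', \<beta>', y'), (\<xi>, \<upsilon>), (x, \<beta>, y)) \<in> hom K (x', \<beta>', y') (x, \<beta>, y)"
proof -
  note t' = t[unfolded comma_obj]
  have \<beta>: "\<beta> \<in> hom M (OMap P x) (OMap Q y)" using t' by simp
  note P\<xi> = functor_hom[OF P_fun c(2)] and Q\<upsilon> = functor_hom[OF Q_fun c'(2)]
    and F\<xi> = functor_hom[OF F_fun c(2)]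
  have x': "x' \<in> Obj X" "y' \<in> Obj Y" using hom_obj[OF X_cat c(2)] hom_obj[OF Y_cat c'(2)] by auto
  have "OMap H y' = OMap F x'"
    using functor_hom[OF H_fun c'(2)] F\<xi> eq by (auto simp: hom_def)
  then have y': "OMap G (OMap Q y') = OMap F x'" using x' fib_1cell_obj[OF right] by simp
  have "AMap G (\<beta> \<cdot>\<^bsub>M\<^esub> AMap P \<xi>) = AMap G (AMap Q \<upsilon>) \<cdot>\<^bsub>A\<^esub> Ide A (OMap F x')"
    using functor_comp[OF G_fun P\<xi> \<beta>] t' fib_1cell_arr[OF left c(2)] fib_1cell_arr[OF right c'(2)]
      eq ide_comp[OF A_cat F\<xi>] comp_ide[OF A_cat F\<xi>] by simp
  moreover have "Ide A (OMap F x') \<in> hom A (OMap G (OMap P x')) (OMap G (OMap Q y'))"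
    using ide_in_hom[OF A_cat functor_obj[OF F_fun x'(1)]] y' fib_1cell_obj[OF left x'(1)] by simp
  ultimately obtain \<beta>' where "\<beta>' \<in> hom M (OMap P x') (OMap Q y')"
    "AMap Q \<upsilon> \<cdot>\<^bsub>M\<^esub> \<beta>' = \<beta> \<cdot>\<^bsub>M\<^esub> AMap P \<xi>" "AMap G \<beta>' = Ide A (OMap F x')"
    using cartesian_factor[OF fib_1cell_cartesian[OF right c'(1)] Q\<upsilon> comp_in_hom[OF M_cat P\<xi> \<beta>]]
    by blast
  then show thesis
    using that[of \<beta>'] t c(2) c'(2) x' by (simp add: comma_hom comma_obj)
qed

lemma comma_componentwise_lifting:
  assumes t: "t \<in> Obj K" and \<alpha>: "\<alpha> \<in> hom A a (OMap U t)"
  obtains s \<xi> \<upsilon> where "(s, (\<xi>, \<upsilon>), t) \<in> hom K s t" "cartesian X A F \<xi>" "cartesian Y A H \<upsilon>"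
    "AMap F \<xi> = \<alpha>" "OMap U s = a"
proof -
  obtain x \<beta> y where te: "t = (x, \<beta>, y)" by (metis prod.collapse)
  note t' = t[unfolded te comma_obj] and over = comma_obj_over[OF t[unfolded te]]
  have \<alpha>1: "\<alpha> \<in> hom A a (OMap F x)" "\<alpha> \<in> hom A a (OMap H y)" using \<alpha> over by (simp_all add: te)
  obtain \<xi> x' where \<xi>: "\<xi> \<in> hom X x' x" "cartesian X A F \<xi>" "AMap F \<xi> = \<alpha>" "OMap F x' = a"
    using fibration_lifting[OF fib_1cell_source[OF left] _ \<alpha>1(1)] t' by blast
  obtain \<upsilon> y' where \<upsilon>: "\<upsilon> \<in> hom Y y' y" "cartesian Y A H \<upsilon>" "AMap H \<upsilon> = \<alpha>"
    using fibration_lifting[OF fib_1cell_source[OF right] _ \<alpha>1(2)] t' by blast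
  obtain \<beta>' where "((x', \<beta>', y'), (\<xi>, \<upsilon>), t) \<in> hom K (x', \<beta>', y') t"
    unfolding te using comma_lifting[OF t[unfolded te] \<xi>(2,1) \<upsilon>(2,1)] \<xi> \<upsilon> by auto
  then show thesis using that \<xi> \<upsilon> by (metis comma_simps(5))
qed

lemma comma_fibration: "fibration K A U"
  unfolding fibration_def
proof (intro conjI comma_functor ballI impI)
  fix t \<alpha> assume t: "t \<in> Obj K" and \<alpha>: "\<alpha> \<in> Arr A" "Cod A \<alpha> = OMap U t"
  obtain s \<xi> \<upsilon> where "(s, (\<xi>, \<upsilon>), t) \<in> hom K s t" "cartesian X A F \<xi>" "cartesian Y A H \<upsilon>"
    "AMap F \<xi> = \<alpha>"
    using comma_componentwise_lifting[OF t] arr_in_hom[OF \<alpha>(1)] \<alpha>(2) by metis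
  then show "\<exists>f. cartesian_lifting K A U \<alpha> t f"
    using comma_cartesianI unfolding cartesian_lifting_def by (metis comma_simps(2,6))
qed

lemma comma_iso_components:
  assumes "iso K (s, (\<xi>, \<upsilon>), t)"
  shows "iso X \<xi>" and "iso Y \<upsilon>"
proof -
  have k: "(s, (\<xi>, \<upsilon>), t) \<in> hom K s t" using assms by (auto simp: iso_def hom_def)
  obtain x \<beta> y x' \<beta>' y' where e: "s = (x, \<beta>, y)" "t = (x', \<beta>', y')"
    by (metis prod.collapse)
  obtain g where g: "g \<in> hom K t s" "g \<cdot>\<^bsub>K\<^esub> (s, (\<xi>, \<upsilon>), t) = Ide K s" "(s, (\<xi>, \<upsilon>), t) \<cdot>\<^bsub>K\<^esub> g = Ide K t"
    using isoE[OF assms k] .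
  obtain \<xi>' \<upsilon>' where ge: "g = (t, (\<xi>', \<upsilon>'), s)" by (rule comma_homE[OF g(1)])
  have "\<xi> \<in> hom X x x'" "\<upsilon> \<in> hom Y y y'" "\<xi>' \<in> hom X x' x" "\<upsilon>' \<in> hom Y y' y"
    using k g(1) unfolding e ge by (simp_all add: comma_hom)
  then show "iso X \<xi>" "iso Y \<upsilon>"
    using g(2,3) by (auto simp: ge e intro: isoI)
qed

text \<open>A cartesian arrow differs by an isomorphism from a lifting that is cartesian in each component, and
  the components of an isomorphism are isomorphisms.\<close>

lemma comma_cartesianD:
  assumes k: "(s, (\<xi>, \<upsilon>), t) \<in> hom K s t" and c: "cartesian K A U (s, (\<xi>, \<upsilon>), t)"
  shows "cartesian X A F \<xi>" and "cartesian Y A H \<upsilon>"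
proof -
  note K = comma_category and U = comma_functor
  have t: "s \<in> Obj K" "t \<in> Obj K" using hom_obj[OF K k] by auto
  obtain s' \<xi>' \<upsilon>' where k': "(s', (\<xi>', \<upsilon>'), t) \<in> hom K s' t" "cartesian X A F \<xi>'" "cartesian Y A H \<upsilon>'"
    "AMap F \<xi>' = AMap F \<xi>" "OMap U s' = OMap U s"
    using comma_componentwise_lifting[OF t(2) functor_hom[OF U k]] unfolding comma_simps .
  note c' = comma_cartesianI[OF k'(1-3)]
  have eq: "AMap U (s, (\<xi>, \<upsilon>), t) = AMap U (s', (\<xi>', \<upsilon>'), t) \<cdot>\<^bsub>A\<^esub> Ide A (OMap U s)"
    using k' comp_ide[OF A_cat functor_hom[OF U k]] by simp
  obtain i where i: "i \<in> hom K s s'" "(s', (\<xi>', \<upsilon>'), t) \<cdot>\<^bsub>K\<^esub> i = (s, (\<xi>, \<upsilon>), t)"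
    "AMap U i = Ide A (OMap U s)"
    using cartesian_factor[OF c' k'(1) k _ eq] ide_in_hom[OF A_cat functor_obj[OF U t(1)]]
    unfolding k'(5) by blast
  have iso: "iso K i"
    using iso_between_cartesian[OF U c k c' k'(1) i(1,2)] i(3)
      iso_ide[OF A_cat functor_obj[OF U t(1)]] by simp
  obtain i1 i2 where ie: "i = (s, (i1, i2), s')" by (rule comma_homE[OF i(1)])
  note isos = comma_iso_components[OF iso[unfolded ie]]
  obtain x \<beta> y x' \<beta>' y' x'' \<beta>'' y'' where e: "s = (x, \<beta>, y)" "t = (x', \<beta>', y')" "s' = (x'', \<beta>'', y'')"
    by (metis prod.collapse)
  have h: "i1 \<in> hom X x x''" "i2 \<in> hom Y y y''" "\<xi>' \<in> hom X x'' x'" "\<upsilon>' \<in> hom Y y'' y'"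
    using i(1) k'(1) unfolding e ie by (simp_all add: comma_hom)
  have "\<xi> = \<xi>' \<cdot>\<^bsub>X\<^esub> i1" "\<upsilon> = \<upsilon>' \<cdot>\<^bsub>Y\<^esub> i2" using i(2) by (simp_all add: ie)
  then show "cartesian X A F \<xi>" "cartesian Y A H \<upsilon>"
    using cartesian_comp[OF F_fun iso_cartesian[OF F_fun isos(1)] h(1) k'(2) h(3)]
      cartesian_comp[OF H_fun iso_cartesian[OF H_fun isos(2)] h(2) k'(3) h(4)] by simp_all
qed

end

section \<open>Left adjoints with identity unit\<close>

text \<open>The object \<open>u\<close> lies strictly over \<open>y\<close>, and the identity of \<open>y\<close> is a universal arrow from
  \<open>y\<close> to \<open>R\<close>: this is the value at \<open>y\<close> of a left adjoint whose unit is an identity.\<close>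

definition universal_over ::
    "('o, 'a) cat \<Rightarrow> ('p, 'b) cat \<Rightarrow> ('o, 'a, 'p, 'b) fmap \<Rightarrow> 'p \<Rightarrow> 'o \<Rightarrow> bool" where
  "universal_over C K R y u \<longleftrightarrow> u \<in> Obj C \<and> OMap R u = y \<and>
     (\<forall>c \<in> Obj C. \<forall>k \<in> hom K y (OMap R c). \<exists>!h. h \<in> hom C u c \<and> AMap R h = k)"

lemma universal_over_factor:
  assumes "universal_over C K R y u" and "c \<in> Obj C" and "k \<in> hom K y (OMap R c)"
  shows "\<exists>!h. h \<in> hom C u c \<and> AMap R h = k"
  using assms by (simp add: universal_over_def)

lemma universal_over_cancel:
  assumes R: "is_functor C K R" and u: "universal_over C K R y u"
    and "h \<in> hom C u c" and "h' \<in> hom C u c" and "AMap R h = AMap R h'"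
  shows "h = h'"
proof -
  have "AMap R h \<in> hom K y (OMap R c)"
    using functor_hom[OF R assms(3)] u by (simp add: universal_over_def)
  from universal_over_factor[OF u hom_obj(2)[OF functor_dom[OF R] assms(3)] this]
  show ?thesis using assms by metis
qed

text \<open>With identity unit, the triangle identities say that \<open>R \<epsilon>\<close> and \<open>\<epsilon> L\<close> are identities; hence
  \<open>\<epsilon> \<cdot> L k\<close> lies over \<open>k\<close>, and naturality of \<open>\<epsilon>\<close> shows that every arrow \<open>h\<close> out of \<open>L y\<close>
  is \<open>\<epsilon> \<cdot> L (R h)\<close>.  The last conclusion holds because an arrow over \<open>k\<close> between values of \<open>L\<close> must be \<open>L k\<close>.\<close>

lemma left_adjoint_identity_unit_imp_universal:
  assumes "fib_has_left_adjoint_identity_unit A (C, U) (K, V) R"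
  obtains L where "\<And>y. y \<in> Obj K \<Longrightarrow> universal_over C K R y (L y)"
    and "\<And>k h. cartesian K A V k \<Longrightarrow> h \<in> hom C (L (Dom K k)) (L (Cod K k)) \<Longrightarrow> AMap R h = k \<Longrightarrow>
      cartesian C A U h"
proof -
  obtain L \<eta> \<epsilon> where L: "fib_1cell A (K, V) (C, U) L" and R: "fib_1cell A (C, U) (K, V) R"
    and \<epsilon>: "nat_trans C C (L \<cdot>\<^sub>F R) id_functor \<epsilon>"
    and \<epsilon>L: "\<And>y. y \<in> Obj K \<Longrightarrow> \<epsilon> (OMap L y) \<cdot>\<^bsub>C\<^esub> AMap L (\<eta> y) = Ide C (OMap L y)"
    and R\<epsilon>: "\<And>x. x \<in> Obj C \<Longrightarrow> AMap R (\<epsilon> x) \<cdot>\<^bsub>K\<^esub> \<eta> (OMap R x) = Ide K (OMap R x)"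
    and RL: "functor_eq K (R \<cdot>\<^sub>F L) id_functor"
    and \<eta>: "\<And>y. y \<in> Obj K \<Longrightarrow> \<eta> y = Ide K y"
    using assms unfolding fib_has_left_adjoint_identity_unit_def fib_adjunction_def fib_2cell_def
      prod.case by blast
  note FL = fib_1cell_functor[OF L] and FR = fib_1cell_functor[OF R]
  note C = functor_dom[OF FR] and K = functor_dom[OF FL]
  have RLo: "OMap R (OMap L y) = y" if "y \<in> Obj K" for y
    using RL that by (simp add: functor_eq_def)
  have RLa: "AMap R (AMap L k) = k" if "k \<in> hom K y y'" for k y y'
    using RL that by (simp add: functor_eq_def hom_def)
  have \<epsilon>h: "\<epsilon> c \<in> hom C (OMap L (OMap R c)) c" if "c \<in> Obj C" for c
    using \<epsilon> that by (simp add: nat_trans_def)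
  have nat: "\<epsilon> c \<cdot>\<^bsub>C\<^esub> AMap L (AMap R h) = h \<cdot>\<^bsub>C\<^esub> \<epsilon> u" if "h \<in> hom C u c" for h u c
    using \<epsilon> that by (auto simp: nat_trans_def hom_def)
  have R\<epsilon>1: "AMap R (\<epsilon> c) = Ide K (OMap R c)" if c: "c \<in> Obj C" for c
  proof -
    have Rc: "OMap R c \<in> Obj K" using functor_obj[OF FR c] .
    have "AMap R (\<epsilon> c) \<in> hom K (OMap R c) (OMap R c)"
      using functor_hom[OF FR \<epsilon>h[OF c]] RLo[OF Rc] by simp
    then show ?thesis using R\<epsilon>[OF c] \<eta>[OF Rc] comp_ide[OF K] by simp
  qed
  have \<epsilon>L1: "\<epsilon> (OMap L y) = Ide C (OMap L y)" if y: "y \<in> Obj K" for y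
  proof -
    have "\<epsilon> (OMap L y) \<in> hom C (OMap L y) (OMap L y)"
      using \<epsilon>h[OF functor_obj[OF FL y]] RLo[OF y] by simp
    then show ?thesis using \<epsilon>L[OF y] \<eta>[OF y] functor_ide[OF FL y] comp_ide[OF C] by simp
  qed
  have uniq: "h = \<epsilon> c \<cdot>\<^bsub>C\<^esub> AMap L (AMap R h)" if "y \<in> Obj K" "h \<in> hom C (OMap L y) c" for h y c
    using nat[OF that(2)] \<epsilon>L1[OF that(1)] comp_ide[OF C that(2)] by simp
  have univ: "universal_over C K R y (OMap L y)" if y: "y \<in> Obj K" for y
    unfolding universal_over_def
  proof (intro conjI ballI)
    show "OMap L y \<in> Obj C" "OMap R (OMap L y) = y" using functor_obj[OF FL y] RLo[OF y] .
    fix c k assume c: "c \<in> Obj C" and k: "k \<in> hom K y (OMap R c)"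
    note Lk = functor_hom[OF FL k]
    show "\<exists>!h. h \<in> hom C (OMap L y) c \<and> AMap R h = k"
    proof (rule ex1I[of _ "\<epsilon> c \<cdot>\<^bsub>C\<^esub> AMap L k"])
      show "\<epsilon> c \<cdot>\<^bsub>C\<^esub> AMap L k \<in> hom C (OMap L y) c \<and> AMap R (\<epsilon> c \<cdot>\<^bsub>C\<^esub> AMap L k) = k"
        using comp_in_hom[OF C Lk \<epsilon>h[OF c]] functor_comp[OF FR Lk \<epsilon>h[OF c]] R\<epsilon>1[OF c] RLa[OF k]
          ide_comp[OF K k] by simp
      show "h = \<epsilon> c \<cdot>\<^bsub>C\<^esub> AMap L k" if "h \<in> hom C (OMap L y) c \<and> AMap R h = k" for h
        using uniq[OF y] that by auto
    qed
  qed
  show thesis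
  proof (rule that[of "OMap L", OF univ])
    fix k h assume k: "cartesian K A V k" and Rh: "AMap R h = k"
      and h: "h \<in> hom C (OMap L (Dom K k)) (OMap L (Cod K k))"
    note k1 = cartesian_arr[OF k]
    have "h = AMap L k"
      using universal_over_cancel[OF FR univ h functor_hom[OF FL k1]] hom_obj(1)[OF K k1]
        RLa[OF k1] Rh by simp
    then show "cartesian C A U h" using fib_1cell_cartesian[OF L k] by simp
  qed
qed

text \<open>Universal arrows determine \<open>L\<close> on arrows and the counit, and all equations between arrows out of
  \<open>L y\<close> can be checked after applying \<open>R\<close>.  Compatibility with the functors to \<open>A\<close>
  and verticality of unit and counit follow from \<open>R\<close> being a functor over \<open>A\<close>, whereas preservation of
  cartesian arrows by \<open>L\<close> is an independent condition.\<close>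

lemma universal_imp_left_adjoint_identity_unit:
  assumes R: "fib_1cell A (C, U) (K, V) R"
    and univ: "\<And>y. y \<in> Obj K \<Longrightarrow> universal_over C K R y (L y)"
    and cart: "\<And>k h. cartesian K A V k \<Longrightarrow> h \<in> hom C (L (Dom K k)) (L (Cod K k)) \<Longrightarrow>
      AMap R h = k \<Longrightarrow> cartesian C A U h"
  shows "fib_has_left_adjoint_identity_unit A (C, U) (K, V) R"
proof -
  note FR = fib_1cell_functor[OF R]
  note C = functor_dom[OF FR] and K = functor_cod[OF FR]
  define L1 where "L1 k = (THE h. h \<in> hom C (L (Dom K k)) (L (Cod K k)) \<and> AMap R h = k)" for k
  define LF where "LF = \<lparr>OMap = L, AMap = L1\<rparr>"
  define \<epsilon> where "\<epsilon> c = (THE h. h \<in> hom C (L (OMap R c)) c \<and> AMap R h = Ide K (OMap R c))" for c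
  have LF [simp]: "OMap LF = L" "AMap LF = L1" by (simp_all add: LF_def)
  have Lo: "L y \<in> Obj C" "OMap R (L y) = y" if "y \<in> Obj K" for y
    using univ[OF that] by (simp_all add: universal_over_def)
  \<comment> \<open>\<open>L1 k\<close> is the arrow over \<open>k\<close>, which has the right target as \<open>L y'\<close> lies over \<open>y'\<close>.\<close>
  have L1: "L1 k \<in> hom C (L y) (L y')" "AMap R (L1 k) = k" if k: "k \<in> hom K y y'" for k y y'
  proof -
    note y = hom_obj[OF K k]
    have "\<exists>!h. h \<in> hom C (L y) (L y') \<and> AMap R h = k"
      using universal_over_factor[OF univ[OF y(1)] Lo(1)[OF y(2)]] k Lo(2)[OF y(2)] by simp
    from theI'[OF this] show "L1 k \<in> hom C (L y) (L y')" "AMap R (L1 k) = k"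
      using k by (simp_all add: L1_def in_hom_dom in_hom_cod)
  qed
  have \<epsilon>: "\<epsilon> c \<in> hom C (L (OMap R c)) c" "AMap R (\<epsilon> c) = Ide K (OMap R c)" if c: "c \<in> Obj C" for c
  proof -
    note Rc = functor_obj[OF FR c]
    from theI'[OF universal_over_factor[OF univ[OF Rc] c ide_in_hom[OF K Rc]]]
    show "\<epsilon> c \<in> hom C (L (OMap R c)) c" "AMap R (\<epsilon> c) = Ide K (OMap R c)"
      by (simp_all add: \<epsilon>_def)
  qed
  note cancel = universal_over_cancel[OF FR univ]
  have FL: "is_functor K C LF"
  proof (rule functorI[OF K C])
    fix y assume y: "y \<in> Obj K"
    show "OMap LF y \<in> Obj C" using Lo[OF y] by simp
    note i = ide_in_hom[OF K y] and i' = ide_in_hom[OF C Lo(1)[OF y]]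
    show "AMap LF (Ide K y) = Ide C (OMap LF y)"
      using cancel[OF y L1(1)[OF i] i'] L1(2)[OF i] functor_ide[OF FR Lo(1)[OF y]] Lo(2)[OF y] by simp
  next
    show "AMap LF f \<in> hom C (OMap LF x) (OMap LF y)" if "f \<in> hom K x y" for f x y
      using L1[OF that] by simp
  next
    fix f g x y z assume f: "f \<in> hom K x y" and g: "g \<in> hom K y z"
    note gf = comp_in_hom[OF K f g]
    show "AMap LF (g \<cdot>\<^bsub>K\<^esub> f) = AMap LF g \<cdot>\<^bsub>C\<^esub> AMap LF f"
      using cancel[OF hom_obj(1)[OF K f] L1(1)[OF gf] comp_in_hom[OF C L1(1)[OF f] L1(1)[OF g]]]
        functor_comp[OF FR L1(1)[OF f] L1(1)[OF g]] L1(2)[OF gf] L1(2)[OF f] L1(2)[OF g] by simp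
  qed
  have L: "fib_1cell A (K, V) (C, U) LF"
  proof (rule fib_1cellI[OF fib_1cell_target[OF R] fib_1cell_source[OF R] FL])
    show "OMap U (OMap LF y) = OMap V y" if "y \<in> Obj K" for y
      using fib_1cell_obj[OF R Lo(1)[OF that]] Lo(2)[OF that] by simp
    show "AMap U (AMap LF k) = AMap V k" if "k \<in> Arr K" for k
      using fib_1cell_arr[OF R L1(1)] L1(2) arr_in_hom[OF that] by auto
    show "cartesian C A U (AMap LF k)" if "cartesian K A V k" for k
      using cart[OF that] L1[OF cartesian_arr[OF that]] by simp
  qed
  have RL: "functor_eq K (R \<cdot>\<^sub>F LF) id_functor"
    using Lo L1 arr_in_hom by (fastforce simp: functor_eq_def)
  note FV = fib_1cell_target_functor[OF R] and FU = fib_1cell_source_functor[OF R]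
  have \<eta>2: "fib_2cell A (K, V) (K, V) id_functor (R \<cdot>\<^sub>F LF) (Ide K)"
    unfolding fib_2cell_def nat_trans_def prod.case
  proof (intro conjI ballI)
    show "fib_1cell A (K, V) (K, V) id_functor" "fib_1cell A (K, V) (K, V) (R \<cdot>\<^sub>F LF)"
      using fib_1cell_id[OF fib_1cell_target[OF R]] fib_1cell_comp[OF L R] .
    fix y assume y: "y \<in> Obj K"
    show "Ide K y \<in> hom K (OMap id_functor y) (OMap (R \<cdot>\<^sub>F LF) y)"
      using ide_in_hom[OF K y] Lo[OF y] by simp
    show "vertical A V (Ide K y)"
      using verticalI[OF functor_obj[OF FV y]] functor_ide[OF FV y] .
  next
    fix k assume "k \<in> Arr K"
    then have k: "k \<in> hom K (Dom K k) (Cod K k)" by (rule arr_in_hom)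
    show "Ide K (Cod K k) \<cdot>\<^bsub>K\<^esub> AMap id_functor k = AMap (R \<cdot>\<^sub>F LF) k \<cdot>\<^bsub>K\<^esub> Ide K (Dom K k)"
      using L1(2)[OF k] ide_comp[OF K k] comp_ide[OF K k] by simp
  qed
  have \<epsilon>2: "fib_2cell A (C, U) (C, U) (LF \<cdot>\<^sub>F R) id_functor \<epsilon>"
    unfolding fib_2cell_def nat_trans_def prod.case
  proof (intro conjI ballI)
    show "fib_1cell A (C, U) (C, U) id_functor" "fib_1cell A (C, U) (C, U) (LF \<cdot>\<^sub>F R)"
      using fib_1cell_id[OF fib_1cell_source[OF R]] fib_1cell_comp[OF R L] .
    fix c assume c: "c \<in> Obj C"
    show "\<epsilon> c \<in> hom C (OMap (LF \<cdot>\<^sub>F R) c) (OMap id_functor c)" using \<epsilon>[OF c] by simp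
    note Rc = functor_obj[OF FR c]
    have "AMap U (\<epsilon> c) = Ide A (OMap V (OMap R c))"
      using fib_1cell_arr[OF R \<epsilon>(1)[OF c]] \<epsilon>(2)[OF c] functor_ide[OF FV Rc] by simp
    then show "vertical A U (\<epsilon> c)" by (rule verticalI[OF functor_obj[OF FV Rc]])
  next
    fix h assume "h \<in> Arr C"
    then have h: "h \<in> hom C (Dom C h) (Cod C h)" by (rule arr_in_hom)
    note c = hom_obj[OF C h] and Rh = functor_hom[OF FR h]
    note Rc = functor_obj[OF FR c(1)]
    note 1 = comp_in_hom[OF C L1(1)[OF Rh] \<epsilon>(1)[OF c(2)]] and 2 = comp_in_hom[OF C \<epsilon>(1)[OF c(1)] h]
    have "AMap R (\<epsilon> (Cod C h) \<cdot>\<^bsub>C\<^esub> L1 (AMap R h)) = AMap R (h \<cdot>\<^bsub>C\<^esub> \<epsilon> (Dom C h))"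
      using functor_comp[OF FR L1(1)[OF Rh] \<epsilon>(1)[OF c(2)]] functor_comp[OF FR \<epsilon>(1)[OF c(1)] h]
        \<epsilon>(2)[OF c(1)] \<epsilon>(2)[OF c(2)] L1(2)[OF Rh] ide_comp[OF K Rh] comp_ide[OF K Rh] by simp
    then show "\<epsilon> (Cod C h) \<cdot>\<^bsub>C\<^esub> AMap (LF \<cdot>\<^sub>F R) h = AMap id_functor h \<cdot>\<^bsub>C\<^esub> \<epsilon> (Dom C h)"
      using cancel[OF Rc 1 2] by simp
  qed
  have \<epsilon>L: "\<epsilon> (L y) \<cdot>\<^bsub>C\<^esub> L1 (Ide K y) = Ide C (L y)" if y: "y \<in> Obj K" for y
  proof -
    note Ly = Lo[OF y] and i = ide_in_hom[OF K y]
    have 1: "\<epsilon> (L y) \<in> hom C (L y) (L y)" "AMap R (\<epsilon> (L y)) = Ide K y"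
      using \<epsilon>[OF Ly(1)] Ly(2) by simp_all
    show ?thesis
      using cancel[OF y comp_in_hom[OF C L1(1)[OF i] 1(1)] ide_in_hom[OF C Ly(1)]]
        functor_comp[OF FR L1(1)[OF i] 1(1)] 1(2) L1(2)[OF i] ide_comp[OF K i]
        functor_ide[OF FR Ly(1)] Ly(2) by simp
  qed
  have R\<epsilon>: "AMap R (\<epsilon> c) \<cdot>\<^bsub>K\<^esub> Ide K (OMap R c) = Ide K (OMap R c)" if c: "c \<in> Obj C" for c
    using \<epsilon>(2)[OF c] ide_comp[OF K ide_in_hom[OF K functor_obj[OF FR c]]] by simp
  have "fib_adjunction A (C, U) (K, V) LF R (Ide K) \<epsilon>"
    using L R \<eta>2 \<epsilon>2 \<epsilon>L R\<epsilon> by (simp add: fib_adjunction_def)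
  then show ?thesis
    using RL unfolding fib_has_left_adjoint_identity_unit_def prod.case by blast
qed

section \<open>Opcartesian liftings of vertical arrows\<close>

definition has_vertical_opliftings ::
    "('p, 'b) cat \<Rightarrow> ('o, 'a, 'p, 'b) over \<Rightarrow> ('q, 'c, 'p, 'b) over \<Rightarrow> ('o, 'a, 'q, 'c) fmap \<Rightarrow> bool" where
  "has_vertical_opliftings A = (\<lambda>(X, F) (M, G) P.
     (\<forall>x \<in> Obj X. \<forall>m. \<forall>\<beta> \<in> hom M (OMap P x) m. AMap G \<beta> = Ide A (OMap F x) \<longrightarrow>
        (\<exists>f. opcartesian_lifting X M P \<beta> x f)))"

text \<open>The arrow \<open>v\<close> is \<open>\<alpha>\<^sup>*b\<close> for \<open>\<alpha> = F c\<close>, formed with arbitrary cartesian liftings \<open>c\<close>, \<open>c'\<close> of \<open>\<alpha>\<close>.\<close>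

definition reindexing_preserves_opcartesian ::
    "('p, 'b) cat \<Rightarrow> ('o, 'a, 'p, 'b) over \<Rightarrow> ('q, 'c, 'p, 'b) over \<Rightarrow> ('o, 'a, 'q, 'c) fmap \<Rightarrow> bool" where
  "reindexing_preserves_opcartesian A = (\<lambda>(X, F) (M, G) P.
     (\<forall>x y x' y'. \<forall>b \<in> hom X x y. \<forall>c \<in> hom X x' x. \<forall>c' \<in> hom X y' y. \<forall>v \<in> hom X x' y'.
        opcartesian X M P b \<longrightarrow> vertical A F b \<longrightarrow> cartesian X A F c \<longrightarrow> cartesian X A F c' \<longrightarrow>
        AMap F c' = AMap F c \<longrightarrow> vertical A F v \<longrightarrow> c' \<cdot>\<^bsub>X\<^esub> v = b \<cdot>\<^bsub>X\<^esub> c \<longrightarrow>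
        opcartesian X M P v))"

lemma fiber_simps [simp]:
  "x \<in> Obj (fiber A (X, F) a) \<longleftrightarrow> x \<in> Obj X \<and> OMap F x = a"
  "f \<in> Arr (fiber A (X, F) a) \<longleftrightarrow> f \<in> Arr X \<and> AMap F f = Ide A a"
  "Dom (fiber A (X, F) a) = Dom X" "Cod (fiber A (X, F) a) = Cod X"
  "Ide (fiber A (X, F) a) = Ide X" "Comp (fiber A (X, F) a) = Comp X"
  "f \<in> hom (fiber A (X, F) a) x y \<longleftrightarrow> f \<in> hom X x y \<and> AMap F f = Ide A a"
  by (auto simp: fiber_def hom_def)

lemma fiber_category:
  assumes F: "is_functor X A F" and a: "a \<in> Obj A"
  shows "category (fiber A (X, F) a)"
proof -
  note X = functor_dom[OF F] and A = functor_cod[OF F]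
  have over: "OMap F x = a" "OMap F y = a" if "f \<in> hom X x y" "AMap F f = Ide A a" for f x y
    using functor_hom[OF F that(1)] ide_inj[OF A a] that(2) by auto
  show ?thesis
    unfolding category_def
  proof (intro conjI ballI impI)
    fix f assume "f \<in> Arr (fiber A (X, F) a)"
    then have f: "f \<in> hom X (Dom X f) (Cod X f)" "AMap F f = Ide A a" by (simp_all add: arr_in_hom)
    show "Dom (fiber A (X, F) a) f \<in> Obj (fiber A (X, F) a)"
      "Cod (fiber A (X, F) a) f \<in> Obj (fiber A (X, F) a)"
      using over[OF f] hom_obj[OF X f(1)] by simp_all
    show "f \<cdot>\<^bsub>fiber A (X, F) a\<^esub> Ide (fiber A (X, F) a) (Dom (fiber A (X, F) a) f) = f"
      "Ide (fiber A (X, F) a) (Cod (fiber A (X, F) a) f) \<cdot>\<^bsub>fiber A (X, F) a\<^esub> f = f"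
      using comp_ide[OF X f(1)] ide_comp[OF X f(1)] by simp_all
    fix g assume "g \<in> Arr (fiber A (X, F) a)" "Dom (fiber A (X, F) a) g = Cod (fiber A (X, F) a) f"
    then have g: "g \<in> hom X (Cod X f) (Cod X g)" "AMap F g = Ide A a" 
      by (auto simp: hom_def)
    show "g \<cdot>\<^bsub>fiber A (X, F) a\<^esub> f \<in> hom (fiber A (X, F) a) (Dom (fiber A (X, F) a) f)
        (Cod (fiber A (X, F) a) g)"
      using comp_in_hom[OF X f(1) g(1)] functor_comp[OF F f(1) g(1)] f(2) g(2)
        ide_comp[OF A ide_in_hom[OF A a]] by simp
    fix h assume "h \<in> Arr (fiber A (X, F) a)" "Dom (fiber A (X, F) a) h = Cod (fiber A (X, F) a) g"
    then have "h \<in> hom X (Cod X g) (Cod X h)" by (auto simp: hom_def)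
    from comp_assoc[OF X f(1) g(1) this]
    show "(h \<cdot>\<^bsub>fiber A (X, F) a\<^esub> g) \<cdot>\<^bsub>fiber A (X, F) a\<^esub> f = h \<cdot>\<^bsub>fiber A (X, F) a\<^esub> (g \<cdot>\<^bsub>fiber A (X, F) a\<^esub> f)"
      by simp
  next
    fix x assume "x \<in> Obj (fiber A (X, F) a)"
    then show "Ide (fiber A (X, F) a) x \<in> hom (fiber A (X, F) a) x x"
      using ide_in_hom[OF X] functor_ide[OF F] by auto
  qed
qed

locale morphism_of_fibrations =
  fixes A :: "('p, 'b) cat"
    and X :: "('o, 'a) cat" and F :: "('o, 'a, 'p, 'b) fmap"
    and M :: "('q, 'c) cat" and G :: "('q, 'c, 'p, 'b) fmap"
    and P :: "('o, 'a, 'q, 'c) fmap"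
  assumes P: "fib_1cell A (X, F) (M, G) P"
begin

lemmas FX = fib_1cell_source[OF P] and GM = fib_1cell_target[OF P]
  and F_functor = fib_1cell_source_functor[OF P] and G_functor = fib_1cell_target_functor[OF P]
  and P_functor = fib_1cell_functor[OF P]
  and GP_obj = fib_1cell_obj[OF P] and GP_arr = fib_1cell_arr[OF P]
  and P_cartesian = fib_1cell_cartesian[OF P]

lemmas catX = functor_dom[OF F_functor] and catM = functor_dom[OF G_functor]
  and catA = functor_cod[OF F_functor]

lemma P_fiber_functor:
  assumes a: "a \<in> Obj A"
  shows "is_functor (fiber A (X, F) a) (fiber A (M, G) a) P"
  by (rule functorI)
    (auto simp: fiber_category[OF F_functor a] fiber_category[OF G_functor a] GP_obj GP_arr
      functor_obj[OF P_functor] functor_ide[OF P_functor] functor_hom[OF P_functor]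
      functor_comp[OF P_functor])

lemma fiber_opcartesianI:
  assumes f: "opcartesian X M P f" and Ff: "AMap F f = Ide A a"
  shows "opcartesian (fiber A (X, F) a) (fiber A (M, G) a) P f"
proof (rule opcartesianI)
  note f1 = opcartesian_arr[OF f]
  show "f \<in> hom (fiber A (X, F) a) (Dom X f) (Cod X f)" using f1 Ff by simp
  fix g z \<psi>
  assume "g \<in> hom (fiber A (X, F) a) (Dom X f) z"
    and "\<psi> \<in> hom (fiber A (M, G) a) (OMap P (Cod X f)) (OMap P z)"
    and "AMap P g = \<psi> \<cdot>\<^bsub>fiber A (M, G) a\<^esub> AMap P f"
  then have g: "g \<in> hom X (Dom X f) z" and \<psi>: "\<psi> \<in> hom M (OMap P (Cod X f)) (OMap P z)"
    "AMap G \<psi> = Ide A a" and eq: "AMap P g = \<psi> \<cdot>\<^bsub>M\<^esub> AMap P f" by auto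
  have "AMap F h = Ide A a" if "h \<in> hom X (Cod X f) z" "AMap P h = \<psi>" for h
    using GP_arr[OF that(1)] that(2) \<psi>(2) by simp
  then show "\<exists>!h. h \<in> hom (fiber A (X, F) a) (Cod X f) z \<and> h \<cdot>\<^bsub>fiber A (X, F) a\<^esub> f = g \<and> AMap P h = \<psi>"
    using opcartesian_unique_factor[OF f f1 g \<psi>(1) eq] by (metis fiber_simps(6,7))
qed

text \<open>Opcartesian arrows of the fibers are global because both \<open>F\<close> and \<open>G\<close> are fibrations and \<open>P\<close>
  preserves cartesian arrows: a lifting problem over \<open>\<alpha>\<close> is transported to the fiber along a cartesian lifting of \<open>\<alpha>\<close>.\<close>

lemma fiber_opcartesianD:
  assumes a: "a \<in> Obj A" and f: "opcartesian (fiber A (X, F) a) (fiber A (M, G) a) P f"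
  shows "opcartesian X M P f" and "AMap F f = Ide A a"
proof -
  let ?x = "Dom X f" and ?y = "Cod X f"
  have f0: "f \<in> hom (fiber A (X, F) a) ?x ?y" using opcartesian_arr[OF f] by simp
  then have f1: "f \<in> hom X ?x ?y" and Ff: "AMap F f = Ide A a" by auto
  show "AMap F f = Ide A a" using Ff .
  have over: "OMap F ?x = a" "OMap F ?y = a"
    using ide_inj[OF catA a] functor_hom[OF F_functor f1] Ff by auto
  note y = hom_obj[OF catX f1] and Pf = functor_hom[OF P_functor f1]
  show "opcartesian X M P f"
  proof (rule opcartesianI[OF f1])
    fix g z \<psi>
    assume g: "g \<in> hom X ?x z" and \<psi>: "\<psi> \<in> hom M (OMap P ?y) (OMap P z)"
      and eq: "AMap P g = \<psi> \<cdot>\<^bsub>M\<^esub> AMap P f"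
    \<comment> \<open>The arrow \<open>\<psi>\<close> lies over \<open>F g\<close> too, since \<open>f\<close> is vertical; so \<open>g\<close> and \<open>\<psi>\<close> factor through
      \<open>c\<close> and \<open>P c\<close> with vertical first factors \<open>g'\<close> and \<open>\<psi>'\<close>.\<close>
    define \<alpha> where "\<alpha> = AMap F g"
    have \<alpha>: "\<alpha> \<in> hom A a (OMap F z)" using functor_hom[OF F_functor g] over by (simp add: \<alpha>_def)
    note z = hom_obj(2)[OF catX g]
    have G\<psi>1: "AMap G \<psi> \<in> hom A a (OMap F z)"
      using functor_hom[OF G_functor \<psi>] GP_obj[OF y(2)] GP_obj[OF z] over by simp
    have G\<psi>: "AMap G \<psi> = \<alpha>"
      using functor_comp[OF G_functor Pf \<psi>] eq GP_arr[OF g] GP_arr[OF f1] Ff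
        comp_ide[OF catA G\<psi>1] by (simp add: \<alpha>_def)
    obtain c w where c: "c \<in> hom X w z" "cartesian X A F c" "AMap F c = \<alpha>" and w: "OMap F w = a"
      using fibration_lifting[OF FX z \<alpha>] .
    note Pc = functor_hom[OF P_functor c(1)] and cP = P_cartesian[OF c(2)]
    note w' = hom_obj(1)[OF catX c(1)] and ida = ide_in_hom[OF catA a]
    obtain g' where g': "g' \<in> hom X ?x w" "c \<cdot>\<^bsub>X\<^esub> g' = g" "AMap F g' = Ide A a"
      by (rule cartesian_factor[OF c(2,1) g, of "Ide A a"])
        (use over w ida comp_ide[OF catA \<alpha>] c(3) in \<open>auto simp: \<alpha>_def\<close>)
    obtain \<psi>' where \<psi>': "\<psi>' \<in> hom M (OMap P ?y) (OMap P w)" "AMap P c \<cdot>\<^bsub>M\<^esub> \<psi>' = \<psi>" "AMap G \<psi>' = Ide A a"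
      by (rule cartesian_factor[OF cP Pc \<psi>, of "Ide A a"])
        (use over w ida comp_ide[OF catA \<alpha>] c(3) GP_obj[OF y(2)] GP_obj[OF w'] GP_arr[OF c(1)] G\<psi>
          in \<open>auto simp: \<alpha>_def\<close>)
    note Pg' = functor_hom[OF P_functor g'(1)]
    have eq': "AMap P g' = \<psi>' \<cdot>\<^bsub>M\<^esub> AMap P f"
    proof (rule cartesian_cancel[OF G_functor cP Pc Pg' comp_in_hom[OF catM Pf \<psi>'(1)]])
      show "AMap P c \<cdot>\<^bsub>M\<^esub> AMap P g' = AMap P c \<cdot>\<^bsub>M\<^esub> (\<psi>' \<cdot>\<^bsub>M\<^esub> AMap P f)"
        using functor_comp[OF P_functor g'(1) c(1)] g'(2) eq comp_assoc[OF catM Pf \<psi>'(1) Pc] \<psi>'(2)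
        by simp
      show "AMap G (AMap P g') = AMap G (\<psi>' \<cdot>\<^bsub>M\<^esub> AMap P f)"
        using functor_comp[OF G_functor Pf \<psi>'(1)] GP_arr[OF g'(1)] GP_arr[OF f1] g'(3) \<psi>'(3) Ff
          comp_ide[OF catA ida] by simp
    qed
    obtain h' where h': "h' \<in> hom X ?y w" "h' \<cdot>\<^bsub>X\<^esub> f = g'" "AMap P h' = \<psi>'"
      using opcartesian_factor[OF f f0, of g' w \<psi>'] g' \<psi>' eq' by auto
    show "\<exists>!h. h \<in> hom X ?y z \<and> h \<cdot>\<^bsub>X\<^esub> f = g \<and> AMap P h = \<psi>"
    proof (rule ex1I[of _ "c \<cdot>\<^bsub>X\<^esub> h'"])
      show "c \<cdot>\<^bsub>X\<^esub> h' \<in> hom X ?y z \<and> (c \<cdot>\<^bsub>X\<^esub> h') \<cdot>\<^bsub>X\<^esub> f = g \<and> AMap P (c \<cdot>\<^bsub>X\<^esub> h') = \<psi>"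
        using comp_in_hom[OF catX h'(1) c(1)] comp_assoc[OF catX f1 h'(1) c(1)] h' g'(2)
          functor_comp[OF P_functor h'(1) c(1)] \<psi>'(2) by simp
      \<comment> \<open>Any other solution also factors through \<open>c\<close>, by an arrow that solves the problem in the fiber.\<close>
      fix h assume h: "h \<in> hom X ?y z \<and> h \<cdot>\<^bsub>X\<^esub> f = g \<and> AMap P h = \<psi>"
      then have h1: "h \<in> hom X ?y z" by simp
      have Fh: "AMap F h = \<alpha>" using GP_arr[OF h1] h G\<psi> by simp
      obtain k where k: "k \<in> hom X ?y w" "c \<cdot>\<^bsub>X\<^esub> k = h" "AMap F k = Ide A a"
        by (rule cartesian_factor[OF c(2,1) h1, of "Ide A a"])
          (use over w ida comp_ide[OF catA \<alpha>] c(3) Fh in auto)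
      note Pk = functor_hom[OF P_functor k(1)]
      have "AMap P k = \<psi>'"
        by (rule cartesian_cancel[OF G_functor cP Pc Pk \<psi>'(1)])
          (use functor_comp[OF P_functor k(1) c(1)] k(2) h \<psi>' GP_arr[OF k(1)] k(3) in auto)
      moreover have "k \<cdot>\<^bsub>X\<^esub> f = g'"
        by (rule cartesian_cancel[OF F_functor c(2,1) comp_in_hom[OF catX f1 k(1)] g'(1)])
          (use comp_assoc[OF catX f1 k(1) c(1)] k h g' functor_comp[OF F_functor f1 k(1)] Ff
            comp_ide[OF catA ida] in auto)
      ultimately have "k = h'"
        using opcartesian_cancel[OF P_fiber_functor[OF a] f f0, of k w h'] k h' 
          GP_arr[OF h'(1)] \<psi>'(3) by simp
      then show "h = c \<cdot>\<^bsub>X\<^esub> h'" using k(2) by simp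
    qed
  qed
qed

lemma fiber_opcartesian_iff:
  "a \<in> Obj A \<Longrightarrow> opcartesian (fiber A (X, F) a) (fiber A (M, G) a) P f \<longleftrightarrow>
    opcartesian X M P f \<and> AMap F f = Ide A a"
  using fiber_opcartesianI fiber_opcartesianD by blast

lemma fiber_opcartesian_lifting_iff:
  assumes "a \<in> Obj A" and "AMap G \<beta> = Ide A a"
  shows "opcartesian_lifting (fiber A (X, F) a) (fiber A (M, G) a) P \<beta> x f \<longleftrightarrow>
    opcartesian_lifting X M P \<beta> x f"
proof -
  have "AMap F f = Ide A a" if "opcartesian X M P f" "AMap P f = \<beta>"
    using GP_arr[OF opcartesian_arr[OF that(1)]] that(2) assms(2) by simp
  then show ?thesis
    by (auto simp: opcartesian_lifting_def fiber_opcartesian_iff[OF assms(1)])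
qed

lemma fiberwise_opfibration_iff:
  "fiberwise_opfibration A (X, F) (M, G) P \<longleftrightarrow> has_vertical_opliftings A (X, F) (M, G) P"
proof
  assume fw: "fiberwise_opfibration A (X, F) (M, G) P"
  show "has_vertical_opliftings A (X, F) (M, G) P"
    unfolding has_vertical_opliftings_def prod.case
  proof (intro ballI allI impI)
    fix x m \<beta> assume x: "x \<in> Obj X" and \<beta>: "\<beta> \<in> hom M (OMap P x) m" "AMap G \<beta> = Ide A (OMap F x)"
    note a = functor_obj[OF F_functor x]
    have "opfibration (fiber A (X, F) (OMap F x)) (fiber A (M, G) (OMap F x)) P"
      using fw a by (simp add: fiberwise_opfibration_def)
    then obtain f where
      "opcartesian_lifting (fiber A (X, F) (OMap F x)) (fiber A (M, G) (OMap F x)) P \<beta> x f"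
      using x \<beta> unfolding opfibration_def
      by (metis fiber_simps(1,2,3) in_hom_arr in_hom_dom)
    then show "\<exists>f. opcartesian_lifting X M P \<beta> x f"
      using fiber_opcartesian_lifting_iff[OF a \<beta>(2)] by blast
  qed
next
  assume lift: "has_vertical_opliftings A (X, F) (M, G) P"
  have "opfibration (fiber A (X, F) a) (fiber A (M, G) a) P" if a: "a \<in> Obj A" for a
    unfolding opfibration_def
  proof (intro conjI ballI impI P_fiber_functor[OF a])
    fix x \<beta> assume "x \<in> Obj (fiber A (X, F) a)" "\<beta> \<in> Arr (fiber A (M, G) a)"
      "Dom (fiber A (M, G) a) \<beta> = OMap P x"
    then have x: "x \<in> Obj X" "OMap F x = a" and \<beta>: "\<beta> \<in> hom M (OMap P x) (Cod M \<beta>)" "AMap G \<beta> = Ide A a"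
      by (auto simp: hom_def)
    then show "\<exists>f. opcartesian_lifting (fiber A (X, F) a) (fiber A (M, G) a) P \<beta> x f"
      using lift x \<beta> fiber_opcartesian_lifting_iff[OF a \<beta>(2)]
      unfolding has_vertical_opliftings_def prod.case by blast
  qed
  then show "fiberwise_opfibration A (X, F) (M, G) P"
    using P by (simp add: fiberwise_opfibration_def)
qed

lemma globally_opcartesian_liftings: "globally_opcartesian_liftings A (X, F) (M, G) P"
  using fiber_opcartesianD(1) by (simp add: globally_opcartesian_liftings_def)

section \<open>The canonical comparison\<close>

lemma reindex_ex1:
  assumes b: "b \<in> hom X x y" "vertical A F b"
    and c: "cartesian X A F c" "c \<in> hom X x' x" and c': "cartesian X A F c'" "c' \<in> hom X y' y"
    and eq: "AMap F c' = AMap F c"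
  shows "\<exists>!v. v \<in> hom X x' y' \<and> vertical A F v \<and> c' \<cdot>\<^bsub>X\<^esub> v = b \<cdot>\<^bsub>X\<^esub> c"
proof -
  note v = vertical_hom[OF F_functor b]
  note x' = functor_obj[OF F_functor hom_obj(1)[OF catX c(2)]]
  note Fc = functor_hom[OF F_functor c(2)] and Fc' = functor_hom[OF F_functor c'(2)]
  have y': "OMap F y' = OMap F x'" using Fc Fc' eq by (auto simp: hom_def)
  have "AMap F (b \<cdot>\<^bsub>X\<^esub> c) = AMap F c' \<cdot>\<^bsub>A\<^esub> Ide A (OMap F x')"
    using functor_comp[OF F_functor c(2) b(1)] v ide_comp[OF catA Fc] comp_ide[OF catA Fc] eq by simp
  then have "\<exists>!v. v \<in> hom X x' y' \<and> c' \<cdot>\<^bsub>X\<^esub> v = b \<cdot>\<^bsub>X\<^esub> c \<and> AMap F v = Ide A (OMap F x')"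
    using cartesian_unique_factor[OF c' comp_in_hom[OF catX c(2) b(1)]] ide_in_hom[OF catA x'] y'
    by simp
  moreover have "AMap F v = Ide A (OMap F x') \<longleftrightarrow> vertical A F v" if "v \<in> hom X x' y'" for v
    using vertical_iff[OF F_functor that] by simp
  ultimately show ?thesis by metis
qed

lemma reindex_eq_iff:
  assumes b: "b \<in> hom X x y" "vertical A F b"
    and c: "cartesian X A F c" "c \<in> hom X x' x" and c': "cartesian X A F c'" "c' \<in> hom X y' y"
    and eq: "AMap F c' = AMap F c"
  shows "reindex A (X, F) c c' b = v \<longleftrightarrow> v \<in> hom X x' y' \<and> vertical A F v \<and> c' \<cdot>\<^bsub>X\<^esub> v = b \<cdot>\<^bsub>X\<^esub> c"
proof -
  have "reindex A (X, F) c c' b = (THE v. v \<in> hom X x' y' \<and> vertical A F v \<and> c' \<cdot>\<^bsub>X\<^esub> v = b \<cdot>\<^bsub>X\<^esub> c)"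
    using in_hom_dom[OF c(2)] in_hom_dom[OF c'(2)] by (simp add: reindex_def)
  then show ?thesis
    using theI'[OF reindex_ex1[OF assms]] the1_equality[OF reindex_ex1[OF assms]] by metis
qed

text \<open>The comparison mediates between the opcartesian arrow \<open>d\<close> and the reindexed arrow \<open>v\<close>, over an identity
  of \<open>M\<close>.  So \<open>v\<close> is opcartesian exactly when it is isomorphic to \<open>d\<close> through the comparison.\<close>

lemma comparison_iso_iff_opcartesian:
  assumes v: "reindex A (X, F) c c' b = v" "v \<in> hom X x' (Dom X c')"
    and d: "opcartesian X M P d" "Dom X d = x'" "AMap P d = AMap P v"
  shows "iso X (comparison A (X, F) (M, G) P b c c' d) \<longleftrightarrow> opcartesian X M P v"
proof -
  let ?z = "Cod X d" and ?y = "Dom X c'"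
  have d1: "d \<in> hom X x' ?z" using opcartesian_arr[OF d(1)] d(2) by simp
  note Pd = functor_hom[OF P_functor d1] and Pv = functor_hom[OF P_functor v(2)]
  have Py: "OMap P ?y = OMap P ?z" using Pd Pv d(3) by (auto simp: hom_def)
  note z = functor_obj[OF P_functor hom_obj(2)[OF catX d1]]
  have "\<exists>!\<omega>. \<omega> \<in> hom X ?z ?y \<and> \<omega> \<cdot>\<^bsub>X\<^esub> d = v \<and> AMap P \<omega> = Ide M (OMap P ?z)"
    by (rule opcartesian_unique_factor[OF d(1) d1 v(2)])
      (use Py ide_in_hom[OF catM z] d(3) ide_comp[OF catM Pd] in simp_all)
  \<comment> \<open>The definition of the comparison asks for \<open>P \<omega>\<close> to be some identity; it can only be this one.\<close>
  moreover have "AMap P \<omega> = Ide M (OMap P ?z) \<longleftrightarrow> vertical M P \<omega>" if "\<omega> \<in> hom X ?z ?y" for \<omega>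
    using vertical_iff[OF P_functor that] by simp
  ultimately have ex1: "\<exists>!\<omega>. \<omega> \<in> hom X ?z ?y \<and> vertical M P \<omega> \<and> \<omega> \<cdot>\<^bsub>X\<^esub> d = v" by metis
  define \<omega> where "\<omega> = comparison A (X, F) (M, G) P b c c' d"
  have \<omega>: "\<omega> \<in> hom X ?z ?y" "vertical M P \<omega>" "\<omega> \<cdot>\<^bsub>X\<^esub> d = v"
    using theI'[OF ex1] v(1) by (simp_all add: \<omega>_def comparison_def)
  have "iso M (AMap P \<omega>)" using vertical_hom(1)[OF P_functor \<omega>(1,2)] iso_ide[OF catM z] by simp
  then have "iso X \<omega> \<longleftrightarrow> opcartesian X M P v"
    using opcartesian_comp_iso[OF P_functor d(1) d1 _ \<omega>(1)] \<omega>(3)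
      iso_between_opcartesian[OF P_functor d(1) d1 _ v(2) \<omega>(1,3)] by auto
  then show ?thesis by (simp add: \<omega>_def)
qed

text \<open>Liftings of vertical arrows provide the arrow \<open>d\<close> without which the condition on comparisons
  would say nothing about a given \<open>v\<close>.\<close>

lemma comparison_iso_iff:
  assumes lift: "has_vertical_opliftings A (X, F) (M, G) P"
  shows "(\<forall>x \<in> Obj X. \<forall>a \<in> Obj A. \<forall>m \<in> Obj M.
         \<forall>\<alpha> \<in> hom A a (OMap F x). \<forall>\<beta> \<in> hom M (OMap P x) m.
           AMap G \<beta> = Ide A (OMap F x) \<longrightarrow> comparison_iso A (X, F) (M, G) P x \<alpha> \<beta>) \<longleftrightarrow>
    reindexing_preserves_opcartesian A (X, F) (M, G) P" (is "?L \<longleftrightarrow> ?R")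
proof
  assume L: ?L
  show ?R
    unfolding reindexing_preserves_opcartesian_def prod.case
  proof (intro allI ballI impI)
    fix x y x' y' b c c' v
    assume b: "b \<in> hom X x y" and c: "c \<in> hom X x' x" and c': "c' \<in> hom X y' y" and v: "v \<in> hom X x' y'"
      and b': "opcartesian X M P b" and bv: "vertical A F b" and cc: "cartesian X A F c"
      and cc': "cartesian X A F c'" and eq: "AMap F c' = AMap F c" and vv: "vertical A F v"
      and sq: "c' \<cdot>\<^bsub>X\<^esub> v = b \<cdot>\<^bsub>X\<^esub> c"
    note ob = hom_obj[OF catX b] and ox' = hom_obj(1)[OF catX c]
    note Fb = vertical_hom[OF F_functor b bv] and Fv = vertical_hom[OF F_functor v vv]
    note Fc = functor_hom[OF F_functor c] and Pb = functor_hom[OF P_functor b]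
      and Pv = functor_hom[OF P_functor v]
    have re: "reindex A (X, F) c c' b = v"
      using reindex_eq_iff[OF b bv cc c cc' c' eq] v vv sq by blast
    have GPv: "AMap G (AMap P v) = Ide A (OMap F x')" using GP_arr[OF v] Fv by simp
    obtain d where d: "opcartesian_lifting X M P (AMap P v) x' d"
      using lift ox' Pv GPv unfolding has_vertical_opliftings_def prod.case by blast
    have "comparison_iso A (X, F) (M, G) P x (AMap F c) (AMap P b)"
      using L ob(1) functor_obj[OF F_functor ox'] functor_obj[OF P_functor ob(2)] Fc Pb
        GP_arr[OF b] Fb(1) by auto
    moreover have "comparison_liftings A (X, F) (M, G) P x (AMap F c) (AMap P b) b c c' d"
      unfolding comparison_liftings_def prod.case
    proof (intro conjI)
      show "opcartesian_lifting (fiber A (X, F) (OMap F x)) (fiber A (M, G) (OMap F x)) P (AMap P b) x b"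
        using fiber_opcartesianI[OF b' Fb(1)] b by (simp add: opcartesian_lifting_def in_hom_dom)
      show "cartesian_lifting X A F (AMap F c) x c" "cartesian_lifting X A F (AMap F c) (Cod X b) c'"
        using cc cc' c c' b eq by (simp_all add: cartesian_lifting_def in_hom_cod)
      show "opcartesian_lifting (fiber A (X, F) (Dom A (AMap F c))) (fiber A (M, G) (Dom A (AMap F c)))
          P (AMap P (reindex A (X, F) c c' b)) (Dom X c) d"
        using fiber_opcartesian_lifting_iff[OF functor_obj[OF F_functor ox'] GPv] d
        by (simp add: re in_hom_dom[OF Fc] in_hom_dom[OF c])
    qed
    ultimately have "iso X (comparison A (X, F) (M, G) P b c c' d)"
      by (auto simp: comparison_iso_def)
    then show "opcartesian X M P v"
      using comparison_iso_iff_opcartesian[OF re] v d c'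
      by (simp add: opcartesian_lifting_def in_hom_dom)
  qed
next
  assume R: ?R
  show ?L
  proof (intro ballI impI)
    fix x a m \<alpha> \<beta>
    assume x: "x \<in> Obj X" and a: "a \<in> Obj A" and \<alpha>: "\<alpha> \<in> hom A a (OMap F x)"
      and \<beta>: "\<beta> \<in> hom M (OMap P x) m" "AMap G \<beta> = Ide A (OMap F x)"
    show "comparison_iso A (X, F) (M, G) P x \<alpha> \<beta>"
      unfolding comparison_iso_def prod.case
    proof (intro allI impI)
      fix b c c' d
      assume "comparison_liftings A (X, F) (M, G) P x \<alpha> \<beta> b c c' d"
      then have b: "opcartesian_lifting X M P \<beta> x b"
        and c: "cartesian X A F c" "Cod X c = x" "AMap F c = \<alpha>"
        and c': "cartesian X A F c'" "Cod X c' = Cod X b" "AMap F c' = \<alpha>"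
        and d: "opcartesian_lifting (fiber A (X, F) a) (fiber A (M, G) a) P
          (AMap P (reindex A (X, F) c c' b)) (Dom X c) d"
        using fiber_opcartesian_lifting_iff[OF functor_obj[OF F_functor x] \<beta>(2)] in_hom_dom[OF \<alpha>]
        by (auto simp: comparison_liftings_def cartesian_lifting_def)
      have b1: "b \<in> hom X x (Cod X b)" "opcartesian X M P b" "AMap P b = \<beta>"
        using b opcartesian_arr by (auto simp: opcartesian_lifting_def)
      have c1: "c \<in> hom X (Dom X c) x" "c' \<in> hom X (Dom X c') (Cod X b)"
        using cartesian_arr[OF c(1)] cartesian_arr[OF c'(1)] c c' by simp_all
      have bv: "vertical A F b"
        using vertical_iff[OF F_functor b1(1)] GP_arr[OF b1(1)] b1(3) \<beta>(2) by simp
      have eq: "AMap F c' = AMap F c" using c c' by simp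
      define v where "v = reindex A (X, F) c c' b"
      have v: "v \<in> hom X (Dom X c) (Dom X c')" "vertical A F v" "c' \<cdot>\<^bsub>X\<^esub> v = b \<cdot>\<^bsub>X\<^esub> c"
        using reindex_eq_iff[OF b1(1) bv c(1) c1(1) c'(1) c1(2) eq, of v] by (simp_all add: v_def)
      have "opcartesian X M P v"
        using R b1(1,2) bv c1 c(1) c'(1) eq v
        unfolding reindexing_preserves_opcartesian_def prod.case by blast
      moreover have "opcartesian X M P d" "Dom X d = Dom X c" "AMap P d = AMap P v"
        using d fiber_opcartesianD(1)[OF a] by (simp_all add: opcartesian_lifting_def v_def)
      ultimately show "iso X (comparison A (X, F) (M, G) P b c c' d)"
        using comparison_iso_iff_opcartesian[OF v_def[symmetric] v(1)] by blast
    qed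
  qed
qed

end

section \<open>Opfibrations in the 2-category of fibrations\<close>

text \<open>Here \<open>C\<close> is \<open>X \<down> X\<close> and \<open>K\<close> is \<open>P \<down> M\<close>, the source and target of the canonical \<open>R\<close>.\<close>

locale morphism_of_fibrations_with_commas = morphism_of_fibrations A X F M G P
  for A :: "('p, 'b) cat"
    and X :: "('o, 'a) cat" and F :: "('o, 'a, 'p, 'b) fmap"
    and M :: "('q, 'c) cat" and G :: "('q, 'c, 'p, 'b) fmap"
    and P :: "('o, 'a, 'q, 'c) fmap" +
  fixes C U K V
  assumes CU: "fib_comma A (X, F) (X, F) (X, F) id_functor id_functor = (C, U)"
    and KV: "fib_comma A (X, F) (M, G) (M, G) P id_functor = (K, V)"
begin

sublocale src: comma_in_Fib A X F X F X F id_functor id_functor C U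
  by unfold_locales (use fib_1cell_id[OF FX] CU in auto)

sublocale tgt: comma_in_Fib A X F M G M G P id_functor K V
  by unfold_locales (use fib_1cell_id[OF GM] P KV in auto)

abbreviation "R \<equiv> canonical_R P"

lemma R_simps [simp]:
  "OMap R (x, \<nu>, y) = (x, AMap P \<nu>, OMap P y)"
  "AMap R (s, (\<xi>, \<upsilon>), t) = (OMap R s, (\<xi>, AMap P \<upsilon>), OMap R t)"
  by (simp_all add: canonical_R_def Let_def)

lemma R_obj: "s \<in> Obj C \<Longrightarrow> OMap R s \<in> Obj K"
  by (cases s)
    (auto simp: src.comma_obj tgt.comma_obj functor_obj[OF P_functor] functor_hom[OF P_functor] GP_arr)

lemma R_hom:
  assumes k: "k \<in> hom C s t"
  shows "AMap R k \<in> hom K (OMap R s) (OMap R t)"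
proof -
  obtain x \<nu> y x' \<nu>' y' \<xi> \<upsilon> where e: "s = (x, \<nu>, y)" "t = (x', \<nu>', y')" "k = (s, (\<xi>, \<upsilon>), t)"
    by (rule src.comma_homE[OF k])
  have h: "s \<in> Obj C" "t \<in> Obj C" "\<xi> \<in> hom X x x'" "\<upsilon> \<in> hom X y y'" "\<nu>' \<cdot>\<^bsub>X\<^esub> \<xi> = \<upsilon> \<cdot>\<^bsub>X\<^esub> \<nu>"
    "\<nu> \<in> hom X x y" "\<nu>' \<in> hom X x' y'"
    using k unfolding e by (simp_all add: src.comma_hom src.comma_obj)
  have "AMap P \<nu>' \<cdot>\<^bsub>M\<^esub> AMap P \<xi> = AMap P \<upsilon> \<cdot>\<^bsub>M\<^esub> AMap P \<nu>"
    using functor_comp[OF P_functor h(3,7)] functor_comp[OF P_functor h(6,4)] h(5) by simp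
  then show ?thesis
    using R_obj[OF h(1)] R_obj[OF h(2)] h(3) functor_hom[OF P_functor h(4)]
    unfolding e by (simp add: tgt.comma_hom)
qed

lemma R_functor: "is_functor C K R"
proof (rule functorI[OF src.comma_category tgt.comma_category])
  show "AMap R (Ide C s) = Ide K (OMap R s)" if "s \<in> Obj C" for s
    using that by (cases s) (auto simp: src.comma_obj functor_ide[OF P_functor])
  show "AMap R (g \<cdot>\<^bsub>C\<^esub> f) = AMap R g \<cdot>\<^bsub>K\<^esub> AMap R f" if f: "f \<in> hom C s t" and g: "g \<in> hom C t u"
    for f g s t u
    by (rule src.comma_homE[OF f], rule src.comma_homE[OF g])
      (auto simp: src.comma_hom functor_comp[OF P_functor])
qed (fact R_obj R_hom)+

lemma R_1cell: "fib_1cell A (C, U) (K, V) R"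
proof (rule fib_1cellI[OF src.comma_fibration tgt.comma_fibration R_functor])
  show "OMap V (OMap R s) = OMap U s" if "s \<in> Obj C" for s
    by (cases s) auto
  show "AMap V (AMap R k) = AMap U k" if k: "k \<in> Arr C" for k
    by (rule src.comma_homE[OF arr_in_hom[OF k]]) auto
  fix k assume k: "cartesian C A U k"
  note k1 = cartesian_arr[OF k]
  obtain s \<xi> \<upsilon> t where e: "k = (s, (\<xi>, \<upsilon>), t)" by (rule src.comma_homE[OF k1])
  have k2: "(s, (\<xi>, \<upsilon>), t) \<in> hom C s t" using k1 by (simp add: e)
  have "AMap R k \<in> hom K (OMap R s) (OMap R t)" using R_hom[OF k2] by (simp add: e)
  then show "cartesian K A V (AMap R k)"
    using tgt.comma_cartesianI src.comma_cartesianD[OF k2 k[unfolded e]] P_cartesian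
    by (simp add: e)
qed

text \<open>An arrow \<open>(x, \<beta>, m) \<rightarrow> R (w, \<nu>, z)\<close> is a pair of \<open>\<xi> : x \<rightarrow> w\<close> and \<open>\<mu> : m \<rightarrow> P z\<close>
  with \<open>P (\<nu> \<cdot> \<xi>) = \<mu> \<cdot> \<beta>\<close>, that is, a lifting problem for \<open>\<nu> \<cdot> \<xi>\<close> against \<open>\<beta>\<close>.  Every lifting
  problem arises in this way from the objects with \<open>\<nu>\<close> an identity.\<close>

lemma universal_over_iff_opcartesian:
  assumes k: "(x, \<beta>, m) \<in> Obj K"
  shows "universal_over C K R (x, \<beta>, m) u \<longleftrightarrow>
    (\<exists>b y. u = (x, b, y) \<and> b \<in> hom X x y \<and> AMap P b = \<beta> \<and> opcartesian X M P b)" (is "?L \<longleftrightarrow> ?R")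
proof
  assume L: ?L
  then have u: "u \<in> Obj C" "OMap R u = (x, \<beta>, m)" by (simp_all add: universal_over_def)
  then obtain b y where ue: "u = (x, b, y)" and Pb: "AMap P b = \<beta>" "OMap P y = m"
    by (cases u) auto
  have b: "b \<in> hom X x y" "AMap F b = Ide A (OMap F x)"
    using u by (simp_all add: ue src.comma_obj)
  have "opcartesian X M P b"
  proof (rule opcartesianI[OF b(1)])
    fix g z \<psi> assume g: "g \<in> hom X x z" and \<psi>: "\<psi> \<in> hom M (OMap P y) (OMap P z)"
      and eq: "AMap P g = \<psi> \<cdot>\<^bsub>M\<^esub> AMap P b"
    note z = hom_obj(2)[OF catX g]
    have zo: "(z, Ide X z, z) \<in> Obj C"
      using z ide_in_hom[OF catX z] functor_ide[OF F_functor z] by (simp add: src.comma_obj)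
    have gz: "Ide X z \<cdot>\<^bsub>X\<^esub> g = g" using ide_comp[OF catX g] .
    have "((x, \<beta>, m), (g, \<psi>), OMap R (z, Ide X z, z)) \<in> hom K (x, \<beta>, m) (OMap R (z, Ide X z, z))"
      using k R_obj[OF zo] g \<psi> eq Pb functor_ide[OF P_functor z]
        ide_comp[OF catM functor_hom[OF P_functor g]] by (simp add: tgt.comma_hom)
    from universal_over_factor[OF L zo this]
    have ex1: "\<exists>!h. h \<in> hom C u (z, Ide X z, z) \<and>
      AMap R h = ((x, \<beta>, m), (g, \<psi>), OMap R (z, Ide X z, z))" .
    have hom_iff: "(u, (g, h), (z, Ide X z, z)) \<in> hom C u (z, Ide X z, z) \<longleftrightarrow>
      h \<in> hom X y z \<and> h \<cdot>\<^bsub>X\<^esub> b = g" for h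
      using u(1) zo g gz by (auto simp: ue src.comma_hom)
    obtain h where h: "h \<in> hom C u (z, Ide X z, z)"
      "AMap R h = ((x, \<beta>, m), (g, \<psi>), OMap R (z, Ide X z, z))" using ex1 by blast
    obtain h0 h1 where he: "h = (u, (h0, h1), (z, Ide X z, z))" by (rule src.comma_homE[OF h(1)])
    have h1: "h1 \<in> hom X y z \<and> h1 \<cdot>\<^bsub>X\<^esub> b = g \<and> AMap P h1 = \<psi>"
      using h hom_iff[of h1] by (simp add: he)
    moreover have "h' = h1" if h': "h' \<in> hom X y z \<and> h' \<cdot>\<^bsub>X\<^esub> b = g \<and> AMap P h' = \<psi>" for h'
    proof -
      have "(u, (g, h'), (z, Ide X z, z)) = h"
        using ex1 h h' hom_iff[of h'] u(2) by (metis R_simps(2))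
      then show ?thesis by (simp add: he)
    qed
    ultimately show "\<exists>!h. h \<in> hom X y z \<and> h \<cdot>\<^bsub>X\<^esub> b = g \<and> AMap P h = \<psi>" by blast
  qed
  then show ?R using ue b Pb by blast
next
  assume ?R
  then obtain b y where ue: "u = (x, b, y)" and b: "b \<in> hom X x y" "AMap P b = \<beta>" "opcartesian X M P b"
    by blast
  note k' = k[unfolded tgt.comma_obj]
  have Py: "OMap P y = m" using functor_hom[OF P_functor b(1)] b(2) k' by (auto simp: hom_def)
  have u: "u \<in> Obj C"
    using hom_obj[OF catX b(1)] b GP_arr[OF b(1)] k' by (simp add: ue src.comma_obj)
  show ?L
    unfolding universal_over_def
  proof (intro conjI ballI u)
    show "OMap R u = (x, \<beta>, m)" using b Py by (simp add: ue)
    fix c f assume c: "c \<in> Obj C" and f: "f \<in> hom K (x, \<beta>, m) (OMap R c)"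
    obtain w \<nu> z where ce: "c = (w, \<nu>, z)" by (cases c)
    have \<nu>: "\<nu> \<in> hom X w z" using c by (simp add: ce src.comma_obj)
    obtain \<xi> \<mu> where fe: "f = ((x, \<beta>, m), (\<xi>, \<mu>), OMap R c)" by (rule tgt.comma_homE[OF f])
    have f': "\<xi> \<in> hom X x w" "\<mu> \<in> hom M m (OMap P z)" "AMap P \<nu> \<cdot>\<^bsub>M\<^esub> AMap P \<xi> = \<mu> \<cdot>\<^bsub>M\<^esub> \<beta>"
      using f unfolding fe ce by (simp_all add: tgt.comma_hom)
    have "\<exists>!h. h \<in> hom X y z \<and> h \<cdot>\<^bsub>X\<^esub> b = \<nu> \<cdot>\<^bsub>X\<^esub> \<xi> \<and> AMap P h = \<mu>"
      using opcartesian_unique_factor[OF b(3,1) comp_in_hom[OF catX f'(1) \<nu>]] f' b(2) Py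
        functor_comp[OF P_functor f'(1) \<nu>] by simp
    then obtain h where h: "h \<in> hom X y z" "h \<cdot>\<^bsub>X\<^esub> b = \<nu> \<cdot>\<^bsub>X\<^esub> \<xi>" "AMap P h = \<mu>"
      and uniq: "\<And>h'. h' \<in> hom X y z \<Longrightarrow> h' \<cdot>\<^bsub>X\<^esub> b = \<nu> \<cdot>\<^bsub>X\<^esub> \<xi> \<Longrightarrow> AMap P h' = \<mu> \<Longrightarrow> h' = h" by blast
    show "\<exists>!h. h \<in> hom C u c \<and> AMap R h = f"
    proof (rule ex1I[of _ "(u, (\<xi>, h), c)"])
      show "(u, (\<xi>, h), c) \<in> hom C u c \<and> AMap R (u, (\<xi>, h), c) = f"
        using u c h f'(1) b Py by (simp add: ue ce fe src.comma_hom)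
      fix k assume k: "k \<in> hom C u c \<and> AMap R k = f"
      then obtain \<xi>' h' where ke: "k = (u, (\<xi>', h'), c)" by (metis src.comma_homE)
      have "\<xi>' = \<xi>" "AMap P h' = \<mu>" using k by (simp_all add: ke fe)
      moreover have "h' \<in> hom X y z" "h' \<cdot>\<^bsub>X\<^esub> b = \<nu> \<cdot>\<^bsub>X\<^esub> \<xi>'"
        using k unfolding ke ue ce by (auto simp: src.comma_hom)
      ultimately show "k = (u, (\<xi>, h), c)" using uniq by (simp add: ke)
    qed
  qed
qed

text \<open>The given \<open>b\<close> and the wanted \<open>v\<close> are compared with the liftings \<open>e\<close> of \<open>P b\<close> and \<open>d\<close> of \<open>P v\<close>
  chosen by the left adjoint.  The left adjoint sends the cartesian arrow \<open>(c, P c')\<close> of the comma object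
  to a square from \<open>d\<close> to \<open>e\<close> with cartesian sides, and this forces \<open>v\<close> to be isomorphic to \<open>d\<close>.\<close>

lemma opfibration_in_Fib_imp:
  assumes "opfibration_in_Fib A (X, F) (M, G) P"
  shows "has_vertical_opliftings A (X, F) (M, G) P"
    and "reindexing_preserves_opcartesian A (X, F) (M, G) P"
proof -
  have "fib_has_left_adjoint_identity_unit A (C, U) (K, V) R"
    using assms CU KV by (simp add: opfibration_in_Fib_def)
  then obtain L where univ: "\<And>s. s \<in> Obj K \<Longrightarrow> universal_over C K R s (L s)"
    and cart: "\<And>k h. cartesian K A V k \<Longrightarrow> h \<in> hom C (L (Dom K k)) (L (Cod K k)) \<Longrightarrow> AMap R h = k \<Longrightarrow>
      cartesian C A U h"
    by (rule left_adjoint_identity_unit_imp_universal) blast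
  have L: "\<exists>b y. L (x, \<beta>, m) = (x, b, y) \<and> b \<in> hom X x y \<and> AMap P b = \<beta> \<and> opcartesian X M P b"
    if "(x, \<beta>, m) \<in> Obj K" for x \<beta> m
    using univ[OF that] universal_over_iff_opcartesian[OF that] by blast
  show "has_vertical_opliftings A (X, F) (M, G) P"
    unfolding has_vertical_opliftings_def prod.case
  proof (intro ballI allI impI)
    fix x m \<beta> assume "x \<in> Obj X" and "\<beta> \<in> hom M (OMap P x) m" "AMap G \<beta> = Ide A (OMap F x)"
    then have "(x, \<beta>, m) \<in> Obj K" using hom_obj(2)[OF catM] by (simp add: tgt.comma_obj)
    from L[OF this] show "\<exists>f. opcartesian_lifting X M P \<beta> x f"
      by (auto simp: opcartesian_lifting_def hom_def)
  qed
  show "reindexing_preserves_opcartesian A (X, F) (M, G) P"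
    unfolding reindexing_preserves_opcartesian_def prod.case
  proof (intro allI ballI impI)
    fix x y x' y' b c c' v
    assume b: "b \<in> hom X x y" and c: "c \<in> hom X x' x" and c': "c' \<in> hom X y' y" and v: "v \<in> hom X x' y'"
      and b': "opcartesian X M P b" and bv: "vertical A F b" and cc: "cartesian X A F c"
      and cc': "cartesian X A F c'" and eq: "AMap F c' = AMap F c" and vv: "vertical A F v"
      and sq: "c' \<cdot>\<^bsub>X\<^esub> v = b \<cdot>\<^bsub>X\<^esub> c"
    let ?s = "(x', AMap P v, OMap P y')" and ?t = "(x, AMap P b, OMap P y)"
    note Pb = functor_hom[OF P_functor b] and Pc = functor_hom[OF P_functor c]
      and Pc' = functor_hom[OF P_functor c'] and Pv = functor_hom[OF P_functor v]
    have s: "?s \<in> Obj K"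
      using hom_obj[OF catX v] functor_obj[OF P_functor] Pv GP_arr[OF v] vertical_hom(1)[OF F_functor v vv]
      by (simp add: tgt.comma_obj)
    have t: "?t \<in> Obj K"
      using hom_obj[OF catX b] functor_obj[OF P_functor] Pb GP_arr[OF b] vertical_hom(1)[OF F_functor b bv]
      by (simp add: tgt.comma_obj)
    have k: "(?s, (c, AMap P c'), ?t) \<in> hom K ?s ?t"
      using s t c Pc' functor_comp[OF P_functor v c'] functor_comp[OF P_functor c b] sq
      by (simp add: tgt.comma_hom)
    have kc: "cartesian K A V (?s, (c, AMap P c'), ?t)"
      using tgt.comma_cartesianI[OF k cc P_cartesian[OF cc']] .
    obtain d w where d: "L ?s = (x', d, w)" "d \<in> hom X x' w" "AMap P d = AMap P v" "opcartesian X M P d"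
      using L[OF s] by blast
    obtain e z where e: "L ?t = (x, e, z)" "e \<in> hom X x z" "AMap P e = AMap P b" "opcartesian X M P e"
      using L[OF t] by blast
    have Lt: "L ?t \<in> Obj C" "OMap R (L ?t) = ?t" using univ[OF t] by (simp_all add: universal_over_def)
    obtain h where h: "h \<in> hom C (L ?s) (L ?t)" "AMap R h = (?s, (c, AMap P c'), ?t)"
      using universal_over_factor[OF univ[OF s] Lt(1), unfolded Lt(2), OF k] by blast
    have hc: "cartesian C A U h"
      using cart[OF kc _ h(2)] h(1) by simp
    obtain h0 h1 where he: "h = (L ?s, (h0, h1), L ?t)" by (rule src.comma_homE[OF h(1)])
    have h1: "h1 \<in> hom X w z" "e \<cdot>\<^bsub>X\<^esub> c = h1 \<cdot>\<^bsub>X\<^esub> d" "AMap P h1 = AMap P c'"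
      using h unfolding he d(1) e(1) by (auto simp: src.comma_hom)
    have h1c: "cartesian X A F h1" using src.comma_cartesianD(2) h(1) hc unfolding he by blast
    have Pw: "OMap P w = OMap P y'" using functor_hom[OF P_functor d(2)] Pv d(3) by (auto simp: hom_def)
    have Pz: "OMap P z = OMap P y" using functor_hom[OF P_functor e(2)] Pb e(3) by (auto simp: hom_def)
    note y = hom_obj(2)[OF catX b] and y' = hom_obj(2)[OF catX v]
    note Py = functor_obj[OF P_functor y] and Py' = functor_obj[OF P_functor y']
    obtain j where j: "j \<in> hom X y z" "j \<cdot>\<^bsub>X\<^esub> b = e" "AMap P j = Ide M (OMap P y)"
      by (rule opcartesian_factor[OF b' b e(2), of "Ide M (OMap P y)"])
        (use ide_in_hom[OF catM Py] Pz e(3) ide_comp[OF catM Pb] in auto)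
    have jiso: "iso X j"
      using iso_between_opcartesian[OF P_functor b' b e(4,2) j(1,2)] iso_ide[OF catM Py] j(3) by simp
    obtain i where i: "i \<in> hom X w y'" "i \<cdot>\<^bsub>X\<^esub> d = v" "AMap P i = Ide M (OMap P y')"
      by (rule opcartesian_factor[OF d(4,2) v, of "Ide M (OMap P y')"])
        (use ide_in_hom[OF catM Py'] Pw d(3) ide_comp[OF catM Pv] in auto)
    note jc' = comp_in_hom[OF catX c' j(1)]
    have jc'c: "cartesian X A F (j \<cdot>\<^bsub>X\<^esub> c')"
      using cartesian_comp[OF F_functor cc' c' iso_cartesian[OF F_functor jiso] j(1)] .
    \<comment> \<open>Both sides solve the same lifting problem against the opcartesian \<open>d\<close>; as \<open>h1\<close> and \<open>j \<cdot> c'\<close>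
      are cartesian and \<open>i\<close> is vertical, \<open>i\<close> is invertible.\<close>
    have "(j \<cdot>\<^bsub>X\<^esub> c') \<cdot>\<^bsub>X\<^esub> i = h1"
    proof (rule opcartesian_cancel[OF P_functor d(4,2) comp_in_hom[OF catX i(1) jc'] h1(1)])
      have "((j \<cdot>\<^bsub>X\<^esub> c') \<cdot>\<^bsub>X\<^esub> i) \<cdot>\<^bsub>X\<^esub> d = j \<cdot>\<^bsub>X\<^esub> (c' \<cdot>\<^bsub>X\<^esub> v)"
        using comp_assoc[OF catX d(2) i(1) jc'] i(2) comp_assoc[OF catX v c' j(1)] by simp
      also have "\<dots> = h1 \<cdot>\<^bsub>X\<^esub> d"
        using sq comp_assoc[OF catX c b j(1)] j(2) h1(2) by simp
      finally show "((j \<cdot>\<^bsub>X\<^esub> c') \<cdot>\<^bsub>X\<^esub> i) \<cdot>\<^bsub>X\<^esub> d = h1 \<cdot>\<^bsub>X\<^esub> d" .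
      show "AMap P ((j \<cdot>\<^bsub>X\<^esub> c') \<cdot>\<^bsub>X\<^esub> i) = AMap P h1"
        using functor_comp[OF P_functor i(1) jc'] functor_comp[OF P_functor c' j(1)] i(3) j(3)
          ide_comp[OF catM Pc'] comp_ide[OF catM Pc'] h1(3) by simp
    qed
    moreover have "iso A (AMap F i)"
      using iso_ide[OF catA functor_obj[OF G_functor Py']] GP_arr[OF i(1)] i(3)
        functor_ide[OF G_functor Py'] by simp
    ultimately have "iso X i"
      using iso_between_cartesian[OF F_functor h1c h1(1) jc'c jc' i(1)] by simp
    then show "opcartesian X M P v"
      using opcartesian_comp_iso[OF P_functor d(4,2) _ i(1)] i(2) by simp
  qed
qed

text \<open>Let \<open>(\<xi>, h1)\<close> be the square between chosen liftings \<open>b\<close> and \<open>b'\<close> over a cartesian arrow \<open>(\<xi>, \<mu>)\<close>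
  of the comma object.  Write \<open>h1 = c' \<cdot> i\<close> with \<open>c'\<close> cartesian and \<open>i\<close> vertical.  Then \<open>i \<cdot> b\<close> is
  the reindexing of \<open>b'\<close>, hence opcartesian, and \<open>P i\<close> is invertible because \<open>\<mu>\<close> and \<open>P c'\<close> are both
  cartesian.  An arrow between opcartesian arrows over an isomorphism is invertible, so \<open>h1\<close> is cartesian.\<close>

lemma opfibration_in_FibI:
  assumes lift: "has_vertical_opliftings A (X, F) (M, G) P"
    and stable: "reindexing_preserves_opcartesian A (X, F) (M, G) P"
  shows "opfibration_in_Fib A (X, F) (M, G) P"
proof -
  have "\<exists>u. universal_over C K R s u" if s: "s \<in> Obj K" for s
  proof -
    obtain x \<beta> m where e: "s = (x, \<beta>, m)" by (cases s)
    obtain b where "opcartesian_lifting X M P \<beta> x b"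
      using lift s unfolding e tgt.comma_obj has_vertical_opliftings_def prod.case id_functor_simps
      by blast
    then have "b \<in> hom X x (Cod X b)" "AMap P b = \<beta>" "opcartesian X M P b"
      using opcartesian_arr[of X M P b] by (simp_all add: opcartesian_lifting_def)
    then have "universal_over C K R s (x, b, Cod X b)"
      using universal_over_iff_opcartesian[OF s[unfolded e]] by (simp add: e)
    then show ?thesis ..
  qed
  then obtain L where univ: "\<And>s. s \<in> Obj K \<Longrightarrow> universal_over C K R s (L s)" by metis
  have "fib_has_left_adjoint_identity_unit A (C, U) (K, V) R"
  proof (rule universal_imp_left_adjoint_identity_unit[OF R_1cell univ])
    fix k h assume k: "cartesian K A V k" and h: "h \<in> hom C (L (Dom K k)) (L (Cod K k))"
      and Rh: "AMap R h = k"
    obtain x \<beta> m x' \<beta>' m' \<xi> \<mu> where st: "Dom K k = (x, \<beta>, m)" "Cod K k = (x', \<beta>', m')"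
      and "k = (Dom K k, (\<xi>, \<mu>), Cod K k)"
      by (rule tgt.comma_homE[OF cartesian_arr[OF k]])
    then have ke: "k = ((x, \<beta>, m), (\<xi>, \<mu>), (x', \<beta>', m'))" by metis
    have k1: "((x, \<beta>, m), (\<xi>, \<mu>), (x', \<beta>', m')) \<in> hom K (x, \<beta>, m) (x', \<beta>', m')"
      using cartesian_arr[OF k] by (simp add: ke)
    note s = hom_obj[OF tgt.comma_category k1]
    have kc: "cartesian X A F \<xi>" "cartesian M A G \<mu>"
      using tgt.comma_cartesianD[OF k1 k[unfolded ke]] .
    have k2: "\<xi> \<in> hom X x x'" "\<mu> \<in> hom M m m'" using k1 by (simp_all add: tgt.comma_hom)
    have over: "AMap G \<mu> = AMap F \<xi>" using tgt.comma_arr_over[OF k1] .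
    obtain b y where b: "L (x, \<beta>, m) = (x, b, y)" "b \<in> hom X x y" "AMap P b = \<beta>" "opcartesian X M P b"
      using univ[OF s(1)] universal_over_iff_opcartesian[OF s(1)] by blast
    obtain b' y' where b': "L (x', \<beta>', m') = (x', b', y')" "b' \<in> hom X x' y'" "AMap P b' = \<beta>'"
      "opcartesian X M P b'"
      using univ[OF s(2)] universal_over_iff_opcartesian[OF s(2)] by blast
    obtain h0 h1 where he: "h = ((x, b, y), (h0, h1), (x', b', y'))"
      by (rule src.comma_homE[OF h]) (auto simp: st b b')
    have h1: "h \<in> hom C (x, b, y) (x', b', y')" using h by (simp add: st b b')
    have h0: "h0 = \<xi>" and Ph1: "AMap P h1 = \<mu>" using Rh by (simp_all add: he ke)
    have h2: "h1 \<in> hom X y y'" "b' \<cdot>\<^bsub>X\<^esub> \<xi> = h1 \<cdot>\<^bsub>X\<^esub> b"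
      using h1 by (simp_all add: he src.comma_hom h0)
    have bv: "AMap F b = Ide A (OMap F x)" "AMap F b' = Ide A (OMap F x')"
      using GP_arr[OF b(2)] GP_arr[OF b'(2)] b b' s by (simp_all add: tgt.comma_obj)
    have "vertical A F b" using bv(1) vertical_iff[OF F_functor b(2)] by simp
    note b_over = vertical_hom(2)[OF F_functor b(2) this]
    have b'v: "vertical A F b'" using bv(2) vertical_iff[OF F_functor b'(2)] by simp
    note b'_over = vertical_hom(2)[OF F_functor b'(2) b'v]
    note y' = hom_obj(2)[OF catX b'(2)] and F\<xi> = functor_hom[OF F_functor k2(1)]
    note Fx = functor_obj[OF F_functor hom_obj(1)[OF catX k2(1)]]
    obtain c' w where c': "c' \<in> hom X w y'" "cartesian X A F c'" "AMap F c' = AMap F \<xi>"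
      "OMap F w = OMap F x"
      using fibration_lifting[OF FX y'] F\<xi> b'_over by metis
    have Fh1: "AMap F h1 = AMap F \<xi>" using GP_arr[OF h2(1)] Ph1 over by simp
    obtain i where i: "i \<in> hom X y w" "c' \<cdot>\<^bsub>X\<^esub> i = h1" "AMap F i = Ide A (OMap F x)"
      by (rule cartesian_factor[OF c'(2,1) h2(1), of "Ide A (OMap F x)"])
        (use c' b_over ide_in_hom[OF catA Fx] Fh1 comp_ide[OF catA F\<xi>] in auto)
    note ib = comp_in_hom[OF catX b(2) i(1)]
    have ibv: "vertical A F (i \<cdot>\<^bsub>X\<^esub> b)"
      using functor_comp[OF F_functor b(2) i(1)] i(3) bv(1) ide_comp[OF catA ide_in_hom[OF catA Fx]]
        verticalI[OF Fx] by simp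
    have "c' \<cdot>\<^bsub>X\<^esub> (i \<cdot>\<^bsub>X\<^esub> b) = b' \<cdot>\<^bsub>X\<^esub> \<xi>"
      using comp_assoc[OF catX b(2) i(1) c'(1)] i(2) h2(2) by simp
    then have opc: "opcartesian X M P (i \<cdot>\<^bsub>X\<^esub> b)"
      using stable b'(2,4) k2(1) c'(1-3) ib b'v kc(1) ibv
      unfolding reindexing_preserves_opcartesian_def prod.case by blast
    note Pi = functor_hom[OF P_functor i(1)] and Pc' = functor_hom[OF P_functor c'(1)]
    have m: "OMap P y = m" "OMap P y' = m'"
      using functor_hom[OF P_functor b(2)] functor_hom[OF P_functor b'(2)] b(3) b'(3) s
      by (auto simp: tgt.comma_obj hom_def)
    have "iso M (AMap P i)"
    proof (rule iso_between_cartesian[OF G_functor kc(2) _ P_cartesian[OF c'(2)] Pc' Pi])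
      show "\<mu> \<in> hom M (OMap P y) (OMap P y')" using k2 m by simp
      show "AMap P c' \<cdot>\<^bsub>M\<^esub> AMap P i = \<mu>" using functor_comp[OF P_functor i(1) c'(1)] i(2) Ph1 by simp
      show "iso A (AMap G (AMap P i))" using GP_arr[OF i(1)] i(3) iso_ide[OF catA Fx] by simp
    qed
    then have "iso X i"
      using iso_between_opcartesian[OF P_functor b(4,2) opc ib i(1)] by simp
    then have "cartesian X A F h1"
      using cartesian_comp[OF F_functor iso_cartesian[OF F_functor] i(1) c'(2,1)] i(2) by simp
    then show "cartesian C A U h"
      using src.comma_cartesianI h1 kc(1) unfolding he h0 by blast
  qed
  then show ?thesis using P CU KV by (simp add: opfibration_in_Fib_def)
qed

end

theorem theorem2p8:
  fixes A :: "('p, 'b) cat"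
    and X :: "('o, 'a) cat" and F :: "('o, 'a, 'p, 'b) fmap"
    and M :: "('q, 'c) cat" and G :: "('q, 'c, 'p, 'b) fmap"
    and P :: "('o, 'a, 'q, 'c) fmap"
  assumes "category A"
    and "fib_1cell A (X, F) (M, G) P"
  defines "I \<equiv> opfibration_in_Fib A (X, F) (M, G) P"
    and "II \<equiv> fiberwise_opfibration A (X, F) (M, G) P \<and>
      (\<forall>x \<in> Obj X. \<forall>a \<in> Obj A. \<forall>m \<in> Obj M.
         \<forall>\<alpha> \<in> hom A a (OMap F x). \<forall>\<beta> \<in> hom M (OMap P x) m.
           AMap G \<beta> = Ide A (OMap F x) \<longrightarrow> comparison_iso A (X, F) (M, G) P x \<alpha> \<beta>)"
    and "III \<equiv> fiberwise_opfibration A (X, F) (M, G) P \<and>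
      globally_opcartesian_liftings A (X, F) (M, G) P \<and>
      (\<forall>x \<in> Obj X. \<forall>a \<in> Obj A. \<forall>m \<in> Obj M.
         \<forall>\<alpha> \<in> hom A a (OMap F x). \<forall>\<beta> \<in> hom M (OMap P x) m.
           AMap G \<beta> = Ide A (OMap F x) \<longrightarrow> comparison_iso A (X, F) (M, G) P x \<alpha> \<beta>)"
  shows "(I \<longleftrightarrow> II) \<and> (II \<longleftrightarrow> III)"
proof -
  obtain C U where CU: "fib_comma A (X, F) (X, F) (X, F) id_functor id_functor = (C, U)"
    by (meson surj_pair)
  obtain K V where KV: "fib_comma A (X, F) (M, G) (M, G) P id_functor = (K, V)"
    by (meson surj_pair)
  interpret morphism_of_fibrations_with_commas A X F M G P C U K V
    by unfold_locales (fact assms(2) CU KV)+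
  have "I \<longleftrightarrow> has_vertical_opliftings A (X, F) (M, G) P \<and>
      reindexing_preserves_opcartesian A (X, F) (M, G) P"
    using opfibration_in_Fib_imp opfibration_in_FibI unfolding I_def by blast
  also have "\<dots> \<longleftrightarrow> II"
    using fiberwise_opfibration_iff comparison_iso_iff unfolding II_def by blast
  finally show ?thesis
    using globally_opcartesian_liftings unfolding II_def III_def by blast
qed

end
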